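(* Let $1\le g\le r$ and let $\Gamma=(\gamma_1,\dots,\gamma_r)$ be a tuple of symmetric noncommutative polynomials in $x_1,\dots,x_g$ with $\gamma_j=x_j$ for $1\le j\le g$. If $A=(A_1,\dots,A_g)$ is a tuple of bounded self-adjoint operators on a Hilbert space $\mathcal H$, then $W^\Gamma(A)$ and $\mathrm{UCP}^\Gamma(\mathcal R_A^\Gamma)$ are isomorphic closed and bounded $\Gamma$-convex sets.
   Context: Polynomials. $\mathbb C\langle x\rangle$ is the free algebra in noncommuting variables $x_1,\dots,x_g$ with the conjugate-linear involution satisfying $x_j^*=x_j$, $(uw)^*=w^*u^*$; $q$ is symmetric if $q^*=q$. For a tuple $X$ of self-adjoint operators $\Gamma(X)=(\gamma_1(X),\dots,\gamma_r(X))$. Graded sets. $\mathbb S_n$ is the set of self-adjoint $n\times n$ complex matrices. A graded set $\boldsymbol K=(K_n)_{n\in\mathbb N}$, $K_n\subseteq\mathbb S^g_n$, is closed if each $K_n$ is closed, and bounded if there is $R\ge0$ with $\sum_jX_j^2\preceq R^2$ for all $X\in\boldsymbol K$. It is free if closed under direct sums and simultaneous unitary conjugation. $(X,V)$, with $X\in\mathbb S^g_n$ and $V:\mathbb C^m\to\mathbb C^n$ an isometry, is a $\Gamma$-pair if $V^*\Gamma(X)V=\Gamma(V^*XV)$. $\boldsymbol K$ is $\Gamma$-convex if it is free and $V^*XV\in\boldsymbol K$ whenever $X\in\boldsymbol K$ and $(X,V)$ is a $\Gamma$-pair. $\Gamma$-ucp maps. $\mathcal R=\mathcal R_A^\Gamma=\operatorname{span}\{I_{\mathcal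 H},\gamma_1(A),\dots,\gamma_r(A)\}$. A linear map $\varphi:\mathcal R\to M_n(\mathbb C)$ is $\Gamma$-ucp if it is unital, completely positive and $\varphi(\gamma_i(A))=\gamma_i(\varphi(A))$ for $1\le i\le r$, where $\varphi(A)=(\varphi(A_1),\dots,\varphi(A_g))$. $\mathrm{UCP}^\Gamma_n(\mathcal R)$ is the set of $\Gamma$-ucp maps $\mathcal R\to M_n(\mathbb C)$ (a subset of the finite-dimensional space of linear maps $\mathcal R\to M_n(\mathbb C)$), $\mathrm{UCP}^\Gamma(\mathcal R)=(\mathrm{UCP}^\Gamma_n(\mathcal R))_n$, and $W^\Gamma(A)=(W_n^\Gamma(A))_n$ with $W_n^\Gamma(A)=\{\varphi(A):\varphi\in\mathrm{UCP}_n^\Gamma(\mathcal R)\}\subseteq\mathbb S_n^g$. For $\varphi\in\mathrm{UCP}^\Gamma_t(\mathcal R)$ and an isometry $V:\mathbb C^s\to\mathbb C^t$, $(\varphi,V)$ is a $\Gamma$-pair if $V^*\gamma_i(\varphi(A))V=\gamma_i(V^*\varphi(A)V)$ for all $i$; $\Gamma$-convexity of $\mathrm{UCP}^\Gamma(\mathcal R)$ means it is closed under direct sums and unitary conjugation and that $V^*\varphi V:R\mapsto V^*\varphi(R)V$ is in $\mathrm{UCP}^\Gamma(\mathcal R)$ for each $\Gamma$-pair $(\varphi,V)$. Two $\Gamma$-convex sets $\boldsymbol K,\boldsymbol K'$ are isomorphic if there are homeomorphisms $\Phi_n:K_n\to K_n'$ ($n\in\mathbb N$) such that $V^*\Phi_n(X)V=\Phi_m(V^*XV)$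 for each $\Gamma$-pair $(X,V)$ with $X\in K_n$ and $V:\mathbb C^m\to\mathbb C^n$. *)

theory Defs
  imports
    "HOL-Analysis.Analysis"
    "HOL-Library.Complex_Order"
    "HOL-Library.Poly_Mapping"
    "Jordan_Normal_Form.Schur_Decomposition"
begin

section \<open>Complex Hilbert spaces and operators on them\<close>

text \<open>
  The inner product is linear in its first argument, as is \<open>v \<bullet>c w\<close> for vectors.  Norm, metric and
  completeness are those of the underlying real Hilbert space, whose inner product is the real
  part of the complex one; positive definiteness is inherited from it.
\<close>

class complex_hilbert_space = real_inner + complete_space +
  fixes scaleC :: "complex \<Rightarrow> 'a \<Rightarrow> 'a"  (infixr \<open>*\<^sub>C\<close> 75)
    and cinner :: "'a \<Rightarrow> 'a \<Rightarrow> complex"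
  assumes scaleC_add_right: "c *\<^sub>C (x + y) = c *\<^sub>C x + c *\<^sub>C y"
    and scaleC_add_left: "(c + d) *\<^sub>C x = c *\<^sub>C x + d *\<^sub>C x"
    and scaleC_scaleC: "c *\<^sub>C d *\<^sub>C x = (c * d) *\<^sub>C x"
    and scaleC_of_real: "complex_of_real t *\<^sub>C x = t *\<^sub>R x"
    and cinner_commute: "cinner x y = cnj (cinner y x)"
    and cinner_add_left: "cinner (x + y) z = cinner x z + cinner y z"
    and cinner_scaleC_left: "cinner (c *\<^sub>C x) y = c * cinner x y"
    and inner_eq_Re_cinner: "inner x y = Re (cinner x y)"

definition bounded_clinear :: "('h::complex_hilbert_space \<Rightarrow> 'h) \<Rightarrow> bool" where
  "bounded_clinear T \<longleftrightarrow> bounded_linear T \<and> (\<forall>c x. T (c *\<^sub>C x) = c *\<^sub>C T x)"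

definition selfadjoint_op :: "('h::complex_hilbert_space \<Rightarrow> 'h) \<Rightarrow> bool" where
  "selfadjoint_op T \<longleftrightarrow> (\<forall>x y. cinner (T x) y = cinner x (T y))"

section \<open>Noncommutative polynomials\<close>

text \<open>
  A word \<open>x\<^sub>i\<^sub>1 \<cdots> x\<^sub>i\<^sub>k\<close> is the list of its indices; variables are numbered from \<open>0\<close>.
  An element of the free algebra is the finitely supported map sending a word to its coefficient.
\<close>

type_synonym ncpoly = "nat list \<Rightarrow>\<^sub>0 complex"

definition nc_polys :: "nat \<Rightarrow> ncpoly set" where
  "nc_polys g = {p. Poly_Mapping.keys p \<subseteq> lists {..<g}}"

definition nc_var :: "nat \<Rightarrow> ncpoly" where
  "nc_var j = Poly_Mapping.single [j] 1"

definition nc_star :: "ncpoly \<Rightarrow> ncpoly" where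
  "nc_star p = Poly_Mapping.map cnj (Poly_Mapping.map_key rev p)"

fun op_word :: "(nat \<Rightarrow> 'h \<Rightarrow> 'h) \<Rightarrow> nat list \<Rightarrow> 'h \<Rightarrow> 'h" where
  "op_word A [] = id"
| "op_word A (j # w) = A j \<circ> op_word A w"

definition op_eval :: "ncpoly \<Rightarrow> (nat \<Rightarrow> 'h \<Rightarrow> 'h) \<Rightarrow> 'h::complex_hilbert_space \<Rightarrow> 'h" where
  "op_eval p A = (\<lambda>x. \<Sum>w\<in>Poly_Mapping.keys p. Poly_Mapping.lookup p w *\<^sub>C op_word A w x)"

section \<open>Complex matrices\<close>

definition mat_sum :: "nat \<Rightarrow> ('i \<Rightarrow> complex mat) \<Rightarrow> 'i set \<Rightarrow> complex mat" where
  "mat_sum n f I = mat n n (\<lambda>ab. \<Sum>i\<in>I. f i $$ ab)"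

fun mat_word :: "nat \<Rightarrow> (nat \<Rightarrow> complex mat) \<Rightarrow> nat list \<Rightarrow> complex mat" where
  "mat_word n X [] = 1\<^sub>m n"
| "mat_word n X (j # w) = X j * mat_word n X w"

definition mat_eval :: "nat \<Rightarrow> ncpoly \<Rightarrow> (nat \<Rightarrow> complex mat) \<Rightarrow> complex mat" where
  "mat_eval n p X =
     mat_sum n (\<lambda>w. Poly_Mapping.lookup p w \<cdot>\<^sub>m mat_word n X w) (Poly_Mapping.keys p)"

definition psd :: "nat \<Rightarrow> complex mat \<Rightarrow> bool" where
  "psd n M \<longleftrightarrow> M \<in> carrier_mat n n \<and> (\<forall>v\<in>carrier_vec n. 0 \<le> (M *\<^sub>v v) \<bullet>c v)"

definition vec_norm2 :: "complex vec \<Rightarrow> real" where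
  "vec_norm2 v = sqrt (Re (v \<bullet>c v))"

definition selfadjoint_mats :: "nat \<Rightarrow> complex mat set" where
  "selfadjoint_mats n = {M \<in> carrier_mat n n. mat_adjoint M = M}"

definition isometry_mat :: "nat \<Rightarrow> nat \<Rightarrow> complex mat \<Rightarrow> bool" where
  "isometry_mat n m V \<longleftrightarrow> V \<in> carrier_mat n m \<and> mat_adjoint V * V = 1\<^sub>m m"

definition unitary_mat :: "nat \<Rightarrow> complex mat \<Rightarrow> bool" where
  "unitary_mat n U \<longleftrightarrow>
     U \<in> carrier_mat n n \<and> mat_adjoint U * U = 1\<^sub>m n \<and> U * mat_adjoint U = 1\<^sub>m n"

definition compress_mat :: "complex mat \<Rightarrow> complex mat \<Rightarrow> complex mat" where
  "compress_mat V M = mat_adjoint V * M * V"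

definition dsum_mat :: "nat \<Rightarrow> nat \<Rightarrow> complex mat \<Rightarrow> complex mat \<Rightarrow> complex mat" where
  "dsum_mat n m M N = four_block_mat M (0\<^sub>m n m) (0\<^sub>m m n) N"

text \<open>
  The type of matrices of all sizes has no topology; a fixed size gets the Euclidean topology of
  its entries.
\<close>

definition mat_topology :: "nat \<Rightarrow> complex mat topology" where
  "mat_topology n =
     pullback_topology (carrier_mat n n) (\<lambda>M. restrict (\<lambda>ab. M $$ ab) ({..<n} \<times> {..<n}))
       (product_topology (\<lambda>_. euclidean) ({..<n} \<times> {..<n}))"

section \<open>Graded sets of self-adjoint matrix tuples\<close>

text \<open>
  Tuples of length \<open>g\<close> are extensional functions on \<open>{..<g}\<close>.  The levels of a graded set are
  indexed by the positive integers; level \<open>0\<close> is ignored throughout.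
\<close>

type_synonym mtuple = "nat \<Rightarrow> complex mat"

definition sa_tuples :: "nat \<Rightarrow> nat \<Rightarrow> mtuple set" where
  "sa_tuples g n = {..<g} \<rightarrow>\<^sub>E selfadjoint_mats n"

definition sa_topology :: "nat \<Rightarrow> nat \<Rightarrow> mtuple topology" where
  "sa_topology g n =
     subtopology (product_topology (\<lambda>_. mat_topology n) {..<g}) (sa_tuples g n)"

definition compress_tuple :: "nat \<Rightarrow> complex mat \<Rightarrow> mtuple \<Rightarrow> mtuple" where
  "compress_tuple g V X = (\<lambda>j\<in>{..<g}. compress_mat V (X j))"

definition dsum_tuple :: "nat \<Rightarrow> nat \<Rightarrow> nat \<Rightarrow> mtuple \<Rightarrow> mtuple \<Rightarrow> mtuple" where
  "dsum_tuple g n m X Y = (\<lambda>j\<in>{..<g}. dsum_mat n m (X j) (Y j))"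

definition graded_set :: "nat \<Rightarrow> (nat \<Rightarrow> mtuple set) \<Rightarrow> bool" where
  "graded_set g K \<longleftrightarrow> (\<forall>n>0. K n \<subseteq> sa_tuples g n)"

definition closed_graded :: "nat \<Rightarrow> (nat \<Rightarrow> mtuple set) \<Rightarrow> bool" where
  "closed_graded g K \<longleftrightarrow> (\<forall>n>0. closedin (sa_topology g n) (K n))"

definition bounded_graded :: "nat \<Rightarrow> (nat \<Rightarrow> mtuple set) \<Rightarrow> bool" where
  "bounded_graded g K \<longleftrightarrow>
     (\<exists>R\<ge>0. \<forall>n>0. \<forall>X\<in>K n.
        psd n (complex_of_real (R\<^sup>2) \<cdot>\<^sub>m 1\<^sub>m n - mat_sum n (\<lambda>j. X j * X j) {..<g}))"

definition free_set :: "nat \<Rightarrow> (nat \<Rightarrow> mtuple set) \<Rightarrow> bool" where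
  "free_set g K \<longleftrightarrow>
     (\<forall>n>0. \<forall>m>0. \<forall>X\<in>K n. \<forall>Y\<in>K m. dsum_tuple g n m X Y \<in> K (n + m)) \<and>
     (\<forall>n>0. \<forall>X\<in>K n. \<forall>U. unitary_mat n U \<longrightarrow> compress_tuple g U X \<in> K n)"

definition gamma_pair ::
  "nat \<Rightarrow> nat \<Rightarrow> (nat \<Rightarrow> ncpoly) \<Rightarrow> nat \<Rightarrow> nat \<Rightarrow> mtuple \<Rightarrow> complex mat \<Rightarrow> bool" where
  "gamma_pair g r \<gamma> n m X V \<longleftrightarrow>
     isometry_mat n m V \<and>
     (\<forall>i<r. compress_mat V (mat_eval n (\<gamma> i) X) = mat_eval m (\<gamma> i) (compress_tuple g V X))"

definition gamma_convex ::
  "nat \<Rightarrow> nat \<Rightarrow> (nat \<Rightarrow> ncpoly) \<Rightarrow> (nat \<Rightarrow> mtuple set) \<Rightarrow> bool" where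
  "gamma_convex g r \<gamma> K \<longleftrightarrow>
     graded_set g K \<and> free_set g K \<and>
     (\<forall>n>0. \<forall>m>0. \<forall>X\<in>K n. \<forall>V. gamma_pair g r \<gamma> n m X V \<longrightarrow> compress_tuple g V X \<in> K m)"

section \<open>\<open>\<Gamma>\<close>-ucp maps\<close>

definition R_space ::
  "nat \<Rightarrow> (nat \<Rightarrow> ncpoly) \<Rightarrow> (nat \<Rightarrow> 'h \<Rightarrow> 'h) \<Rightarrow> ('h::complex_hilbert_space \<Rightarrow> 'h) set" where
  "R_space r \<gamma> A =
     {T. \<exists>c d. T = (\<lambda>x. c *\<^sub>C x + (\<Sum>i<r. d i *\<^sub>C op_eval (\<gamma> i) A x))}"

text \<open>
  Maps on \<open>S\<close> are extensional, so that equality of such maps is equality on \<open>S\<close>.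
\<close>

definition linear_maps ::
  "('h::complex_hilbert_space \<Rightarrow> 'h) set \<Rightarrow> nat \<Rightarrow> (('h \<Rightarrow> 'h) \<Rightarrow> complex mat) set" where
  "linear_maps S n =
     {\<phi> \<in> S \<rightarrow>\<^sub>E carrier_mat n n.
        (\<forall>T\<in>S. \<forall>T'\<in>S. \<phi> (\<lambda>x. T x + T' x) = \<phi> T + \<phi> T') \<and>
        (\<forall>T\<in>S. \<forall>c. \<phi> (\<lambda>x. c *\<^sub>C T x) = c \<cdot>\<^sub>m \<phi> T)}"

text \<open>
  This is the topology of pointwise convergence; for finite-dimensional \<open>S\<close> it is the only
  Hausdorff vector space topology, hence also the norm topology.
\<close>

definition linear_maps_topology ::
  "('h::complex_hilbert_space \<Rightarrow> 'h) set \<Rightarrow> nat \<Rightarrow> (('h \<Rightarrow> 'h) \<Rightarrow> complex mat) topology" where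
  "linear_maps_topology S n =
     subtopology (product_topology (\<lambda>_. mat_topology n) S) (linear_maps S n)"

text \<open>
  Positivity of a \<open>k \<times> k\<close> matrix of operators on \<open>\<H>\<close> (of \<open>n \<times> n\<close> matrices) is positivity of the
  operator it defines on \<open>\<H>\<^sup>k\<close> (on \<open>(\<complex>\<^sup>n)\<^sup>k\<close>).
\<close>

definition pos_op_matrix ::
  "nat \<Rightarrow> (nat \<Rightarrow> nat \<Rightarrow> 'h::complex_hilbert_space \<Rightarrow> 'h) \<Rightarrow> bool" where
  "pos_op_matrix k T \<longleftrightarrow>
     (\<forall>x :: nat \<Rightarrow> 'h. 0 \<le> (\<Sum>i<k. \<Sum>j<k. cinner (T i j (x j)) (x i)))"

definition pos_mat_matrix :: "nat \<Rightarrow> nat \<Rightarrow> (nat \<Rightarrow> nat \<Rightarrow> complex mat) \<Rightarrow> bool" where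
  "pos_mat_matrix n k M \<longleftrightarrow>
     (\<forall>v. (\<forall>i<k. v i \<in> carrier_vec n) \<longrightarrow> 0 \<le> (\<Sum>i<k. \<Sum>j<k. (M i j *\<^sub>v v j) \<bullet>c v i))"

definition completely_positive ::
  "('h::complex_hilbert_space \<Rightarrow> 'h) set \<Rightarrow> nat \<Rightarrow> (('h \<Rightarrow> 'h) \<Rightarrow> complex mat) \<Rightarrow> bool" where
  "completely_positive S n \<phi> \<longleftrightarrow>
     (\<forall>k T. (\<forall>i<k. \<forall>j<k. T i j \<in> S) \<and> pos_op_matrix k T \<longrightarrow>
        pos_mat_matrix n k (\<lambda>i j. \<phi> (T i j)))"

definition map_tuple ::
  "nat \<Rightarrow> (nat \<Rightarrow> 'h \<Rightarrow> 'h) \<Rightarrow> (('h \<Rightarrow> 'h) \<Rightarrow> complex mat) \<Rightarrow> mtuple" where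
  "map_tuple g A \<phi> = (\<lambda>j\<in>{..<g}. \<phi> (A j))"

definition UCP ::
  "nat \<Rightarrow> nat \<Rightarrow> (nat \<Rightarrow> ncpoly) \<Rightarrow> (nat \<Rightarrow> 'h \<Rightarrow> 'h) \<Rightarrow> nat \<Rightarrow>
     (('h::complex_hilbert_space \<Rightarrow> 'h) \<Rightarrow> complex mat) set" where
  "UCP g r \<gamma> A n =
     {\<phi> \<in> linear_maps (R_space r \<gamma> A) n.
        \<phi> id = 1\<^sub>m n \<and> completely_positive (R_space r \<gamma> A) n \<phi> \<and>
        (\<forall>i<r. \<phi> (op_eval (\<gamma> i) A) = mat_eval n (\<gamma> i) (map_tuple g A \<phi>))}"

definition W_range ::
  "nat \<Rightarrow> nat \<Rightarrow> (nat \<Rightarrow> ncpoly) \<Rightarrow> (nat \<Rightarrow> 'h::complex_hilbert_space \<Rightarrow> 'h) \<Rightarrow> nat \<Rightarrow> mtuple set" where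
  "W_range g r \<gamma> A n = map_tuple g A ` UCP g r \<gamma> A n"

definition compress_map ::
  "('h \<Rightarrow> 'h) set \<Rightarrow> complex mat \<Rightarrow> (('h \<Rightarrow> 'h) \<Rightarrow> complex mat) \<Rightarrow> ('h \<Rightarrow> 'h) \<Rightarrow> complex mat" where
  "compress_map S V \<phi> = (\<lambda>T\<in>S. compress_mat V (\<phi> T))"

definition dsum_map ::
  "('h \<Rightarrow> 'h) set \<Rightarrow> nat \<Rightarrow> nat \<Rightarrow> (('h \<Rightarrow> 'h) \<Rightarrow> complex mat) \<Rightarrow>
     (('h \<Rightarrow> 'h) \<Rightarrow> complex mat) \<Rightarrow> ('h \<Rightarrow> 'h) \<Rightarrow> complex mat" where
  "dsum_map S n m \<phi> \<psi> = (\<lambda>T\<in>S. dsum_mat n m (\<phi> T) (\<psi> T))"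

text \<open>
  In the following three definitions \<open>K n\<close> is a set of linear maps from \<open>R_space r \<gamma> A\<close> to the
  \<open>n \<times> n\<close> matrices.  A pair \<open>(\<phi>, V)\<close> of such a map and an isometry is a \<open>\<Gamma>\<close>-pair iff
  \<open>(\<phi>(A), V)\<close> is one; boundedness is in operator norm, uniformly over all levels.
\<close>

definition gamma_convex_maps ::
  "nat \<Rightarrow> nat \<Rightarrow> (nat \<Rightarrow> ncpoly) \<Rightarrow> (nat \<Rightarrow> 'h::complex_hilbert_space \<Rightarrow> 'h) \<Rightarrow>
     (nat \<Rightarrow> (('h \<Rightarrow> 'h) \<Rightarrow> complex mat) set) \<Rightarrow> bool" where
  "gamma_convex_maps g r \<gamma> A K \<longleftrightarrow>
     (\<forall>n>0. K n \<subseteq> linear_maps (R_space r \<gamma> A) n) \<and>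
     (\<forall>n>0. \<forall>m>0. \<forall>\<phi>\<in>K n. \<forall>\<psi>\<in>K m. dsum_map (R_space r \<gamma> A) n m \<phi> \<psi> \<in> K (n + m)) \<and>
     (\<forall>n>0. \<forall>\<phi>\<in>K n. \<forall>U. unitary_mat n U \<longrightarrow> compress_map (R_space r \<gamma> A) U \<phi> \<in> K n) \<and>
     (\<forall>n>0. \<forall>m>0. \<forall>\<phi>\<in>K n. \<forall>V. gamma_pair g r \<gamma> n m (map_tuple g A \<phi>) V \<longrightarrow>
        compress_map (R_space r \<gamma> A) V \<phi> \<in> K m)"

definition closed_graded_maps ::
  "nat \<Rightarrow> (nat \<Rightarrow> ncpoly) \<Rightarrow> (nat \<Rightarrow> 'h::complex_hilbert_space \<Rightarrow> 'h) \<Rightarrow>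
     (nat \<Rightarrow> (('h \<Rightarrow> 'h) \<Rightarrow> complex mat) set) \<Rightarrow> bool" where
  "closed_graded_maps r \<gamma> A K \<longleftrightarrow>
     (\<forall>n>0. closedin (linear_maps_topology (R_space r \<gamma> A) n) (K n))"

definition bounded_graded_maps ::
  "nat \<Rightarrow> (nat \<Rightarrow> ncpoly) \<Rightarrow> (nat \<Rightarrow> 'h::complex_hilbert_space \<Rightarrow> 'h) \<Rightarrow>
     (nat \<Rightarrow> (('h \<Rightarrow> 'h) \<Rightarrow> complex mat) set) \<Rightarrow> bool" where
  "bounded_graded_maps r \<gamma> A K \<longleftrightarrow>
     (\<exists>C\<ge>0. \<forall>n>0. \<forall>\<phi>\<in>K n. \<forall>T\<in>R_space r \<gamma> A. \<forall>v\<in>carrier_vec n.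
        vec_norm2 (\<phi> T *\<^sub>v v) \<le> C * onorm T * vec_norm2 v)"

section \<open>Isomorphism\<close>

text \<open>
  Stated once for both kinds of graded sets.  The levels \<open>K n\<close> and \<open>K' n\<close> carry the subspace
  topologies from \<open>\<T> n\<close> and \<open>\<T>' n\<close>, \<open>cmp\<close> and \<open>cmp'\<close> are the respective operations
  \<open>X \<mapsto> V\<^sup>* X V\<close>, and \<open>pair n m X V\<close> says that \<open>(X, V)\<close> is a \<open>\<Gamma>\<close>-pair with \<open>V : \<complex>\<^sup>m \<rightarrow> \<complex>\<^sup>n\<close>.
\<close>

definition gamma_isomorphic ::
  "(nat \<Rightarrow> nat \<Rightarrow> 'a \<Rightarrow> complex mat \<Rightarrow> bool) \<Rightarrow>
     (nat \<Rightarrow> 'a topology) \<Rightarrow> (complex mat \<Rightarrow> 'a \<Rightarrow> 'a) \<Rightarrow> (nat \<Rightarrow> 'a set) \<Rightarrow>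
     (nat \<Rightarrow> 'b topology) \<Rightarrow> (complex mat \<Rightarrow> 'b \<Rightarrow> 'b) \<Rightarrow> (nat \<Rightarrow> 'b set) \<Rightarrow> bool" where
  "gamma_isomorphic pair \<T> cmp K \<T>' cmp' K' \<longleftrightarrow>
     (\<exists>\<Phi>. (\<forall>n>0. homeomorphic_map (subtopology (\<T> n) (K n)) (subtopology (\<T>' n) (K' n)) (\<Phi> n)) \<and>
          (\<forall>n>0. \<forall>m>0. \<forall>X\<in>K n. \<forall>V. pair n m X V \<longrightarrow> cmp' V (\<Phi> n X) = \<Phi> m (cmp V X)))"

end

theory Submission
  imports Defs
begin

text \<open>
  A \<open>\<Gamma>\<close>-ucp map \<open>\<phi>\<close> is determined by \<open>X = \<phi>(A)\<close>, since it must send \<open>c + \<Sum>\<^sub>i d\<^sub>i \<gamma>\<^sub>i(A)\<close> to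
  \<open>c + \<Sum>\<^sub>i d\<^sub>i \<gamma>\<^sub>i(X)\<close>.  Both \<open>\<phi> \<mapsto> \<phi>(A)\<close> and this inverse are continuous and commute with compressions
  and direct sums.  The conditions defining \<open>\<Gamma>\<close>-ucp maps are closed under pointwise convergence, and
  pulling them back along the inverse shows that \<open>W\<^sup>\<Gamma>(A)\<close> is closed.  Applying \<open>\<phi>\<close> to the positive operator
  matrix with rows \<open>(\<parallel>T\<parallel>, T)\<close> and \<open>(T\<^sup>*, \<parallel>T\<parallel>)\<close> gives \<open>\<phi>(T\<^sup>*) = \<phi>(T)\<^sup>*\<close> and \<open>\<parallel>\<phi>(T)\<parallel> \<le> \<parallel>T\<parallel>\<close>, hence both bounds.
\<close>

text \<open>A continuous image of a closed set need not be closed, so W is not closed merely because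
  it is the image of the set of \<Gamma>-ucp maps. Instead the inverse of \<phi> \<mapsto> \<phi>(A)
  is extended from W to all self-adjoint tuples X. If 1 and the \<gamma>_i(A) are linearly
  dependent, the extension depends on a choice of coefficients, and for X outside W it may fail to
  be linear or to send A_j to X_j. Both properties are therefore imposed as closed conditions on X,
  and closedness of the \<Gamma>-ucp maps is proved in the space of all matrix-valued maps on the
  operator system, linear or not.

  The norm bound cannot go through a Schwarz inequality, since the product of T^* and T may leave
  the operator system. The two by two matrix needs only multiples of 1, T and T^*, and these stay in
  the span because the \<gamma>_i are symmetric. A \<Gamma>-ucp map is not assumed to respect
  adjoints: this is extracted first, from the fact that a nonnegative number is real, and the norm
  bound then relies on it.\<close>

unbundle no vec_syntax
unbundle no inner_syntax

section \<open>Complex Hilbert spaces\<close>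

lemma cinner_add_right:
  fixes x :: "'h::complex_hilbert_space"
  shows "cinner x (y + z) = cinner x y + cinner x z"
  by (metis cinner_add_left cinner_commute complex_cnj_add)

lemma cinner_scaleC_right:
  fixes x :: "'h::complex_hilbert_space"
  shows "cinner x (c *\<^sub>C y) = cnj c * cinner x y"
  by (metis cinner_commute cinner_scaleC_left complex_cnj_mult)

lemma scaleC_one [simp]: "1 *\<^sub>C x = (x::'h::complex_hilbert_space)"
  using scaleC_of_real[of 1 x] by simp

lemma scaleC_zero_left [simp]: "0 *\<^sub>C x = (0::'h::complex_hilbert_space)"
  using scaleC_of_real[of 0 x] by simp

lemma scaleC_zero_right [simp]: "c *\<^sub>C 0 = (0::'h::complex_hilbert_space)"
  using scaleC_add_right[of c "0::'h" 0] by simp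

lemma scaleC_sum_right:
  "c *\<^sub>C (\<Sum>i\<in>I. f i) = (\<Sum>i\<in>I. c *\<^sub>C (f i :: 'h::complex_hilbert_space))"
  by (induction I rule: infinite_finite_induct) (auto simp: scaleC_add_right)

lemma cinner_zero_left [simp]: "cinner 0 x = 0"
  using cinner_scaleC_left[of 0 0 x] by simp

lemma cinner_zero_right [simp]: "cinner x 0 = 0"
  using cinner_scaleC_right[of x 0 0] by simp

lemma cinner_sum_left: "cinner (\<Sum>i\<in>I. f i) x = (\<Sum>i\<in>I. cinner (f i) x)"
  by (induction I rule: infinite_finite_induct) (auto simp: cinner_add_left)

lemma cinner_sum_right: "cinner x (\<Sum>i\<in>I. f i) = (\<Sum>i\<in>I. cinner x (f i))"
  by (induction I rule: infinite_finite_induct) (auto simp: cinner_add_right)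

lemma cinner_self: "cinner x x = of_real ((norm x)\<^sup>2)"
proof (rule complex_eqI)
  show "Re (cinner x x) = Re (of_real ((norm x)\<^sup>2))"
    by (simp add: inner_eq_Re_cinner[symmetric] power2_norm_eq_inner)
  have "Im (cinner x x) = - Im (cinner x x)"
    by (metis cinner_commute cnj.simps(2))
  then show "Im (cinner x x) = Im (of_real ((norm x)\<^sup>2))" by simp
qed

text \<open>\<open>real_inner\<close> makes the norm homogeneous for real scalars only; the complex
  case comes from expanding the inner product of \<open>c *\<^sub>C x\<close> with itself.\<close>

lemma norm_scaleC: "norm (c *\<^sub>C x) = cmod c * norm (x::'h::complex_hilbert_space)"
proof -
  have "complex_of_real ((norm (c *\<^sub>C x))\<^sup>2) = c * cnj c * of_real ((norm x)\<^sup>2)"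
    by (simp only: cinner_self[symmetric] cinner_scaleC_left cinner_scaleC_right mult_ac)
  also have "\<dots> = of_real ((cmod c * norm x)\<^sup>2)"
    by (simp add: complex_norm_square[symmetric] power_mult_distrib)
  finally have "complex_of_real ((norm (c *\<^sub>C x))\<^sup>2) = of_real ((cmod c * norm x)\<^sup>2)" .
  then have "(norm (c *\<^sub>C x))\<^sup>2 = (cmod c * norm x)\<^sup>2"
    using of_real_eq_iff by blast
  then show ?thesis
    by (simp add: power2_eq_iff_nonneg)
qed

lemma bounded_linear_scaleC: "bounded_linear ((*\<^sub>C) c :: 'h \<Rightarrow> 'h::complex_hilbert_space)"
proof (rule bounded_linear_intro[where K = "cmod c"])
  show "c *\<^sub>C t *\<^sub>R x = t *\<^sub>R c *\<^sub>C x" for t and x :: 'h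
    by (simp add: scaleC_of_real[symmetric] scaleC_scaleC mult.commute)
qed (auto simp: scaleC_add_right norm_scaleC)

section \<open>Noncommutative polynomials in operators\<close>

lemma op_word_append: "op_word A (u @ w) = op_word A u \<circ> op_word A w"
  by (induction u) (auto simp: o_assoc)

lemma bounded_linear_op_word:
  assumes "\<And>j. j < g \<Longrightarrow> bounded_clinear (A j)" and "w \<in> lists {..<g}"
  shows "bounded_linear (op_word A w)"
  using assms(2)
proof (induction w)
  case Nil
  show ?case by (simp add: id_def)
next
  case (Cons j w)
  then show ?case
    using assms(1) by (auto simp: bounded_clinear_def comp_def intro: bounded_linear_compose)
qed

lemma bounded_linear_op_eval:
  assumes "\<And>j. j < g \<Longrightarrow> bounded_clinear (A j)" and "p \<in> nc_polys g"
  shows "bounded_linear (op_eval p A)"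
  unfolding op_eval_def
proof (rule bounded_linear_sum)
  fix w assume "w \<in> Poly_Mapping.keys p"
  then have "w \<in> lists {..<g}" using assms(2) by (auto simp: nc_polys_def)
  then show "bounded_linear (\<lambda>x. Poly_Mapping.lookup p w *\<^sub>C op_word A w x)"
    using bounded_linear_compose[OF bounded_linear_scaleC bounded_linear_op_word] assms(1)
    by blast
qed

text \<open>The letters cross to the other side one at a time, the leftmost first, so the word
  arrives reversed.\<close>

lemma cinner_op_word:
  assumes "\<And>j. j < g \<Longrightarrow> selfadjoint_op (A j)" and "w \<in> lists {..<g}"
  shows "cinner (op_word A w x) y = cinner x (op_word A (rev w) y)"
  using assms(2)
proof (induction w arbitrary: x y)
  case Nil
  show ?case by simp
next
  case (Cons j w)
  then show ?case
    using assms(1) by (auto simp: selfadjoint_op_def op_word_append)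
qed

lemma lookup_nc_star:
  "Poly_Mapping.lookup (nc_star p) w = cnj (Poly_Mapping.lookup p (rev w))"
  by (simp add: nc_star_def map.rep_eq map_key.rep_eq inj_on_def when_def)

lemma selfadjoint_op_eval:
  assumes "\<And>j. j < g \<Longrightarrow> selfadjoint_op (A j)" and "p \<in> nc_polys g" and "nc_star p = p"
  shows "selfadjoint_op (op_eval p A)"
  unfolding selfadjoint_op_def
proof (intro allI)
  fix x y
  have sym: "Poly_Mapping.lookup p (rev w) = cnj (Poly_Mapping.lookup p w)" for w
    using lookup_nc_star[of p "rev w"] assms(3) by simp
  have words: "w \<in> lists {..<g}" if "w \<in> Poly_Mapping.keys p" for w
    using that assms(2) by (auto simp: nc_polys_def)
  have "cinner (op_eval p A x) y
      = (\<Sum>w\<in>Poly_Mapping.keys p. Poly_Mapping.lookup p w * cinner x (op_word A (rev w) y))"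
    by (simp add: op_eval_def cinner_sum_left cinner_scaleC_left
        cinner_op_word[OF assms(1) words] cong: sum.cong)
  \<comment> \<open>Reversal permutes the words occurring in p, because by \<open>sym\<close> a word
    and its reverse have conjugate coefficients.\<close>
  also have "\<dots> = (\<Sum>w\<in>Poly_Mapping.keys p. Poly_Mapping.lookup p (rev w) * cinner x (op_word A w y))"
    by (rule sum.reindex_bij_witness[of _ rev rev]) (auto simp: in_keys_iff sym)
  also have "\<dots> = cinner x (op_eval p A y)"
    by (simp add: op_eval_def cinner_sum_right cinner_scaleC_right sym)
  finally show "cinner (op_eval p A x) y = cinner x (op_eval p A y)" .
qed

lemma op_eval_nc_var: "op_eval (nc_var j) A = A j"
  by (simp add: op_eval_def nc_var_def fun_eq_iff)

text \<open>Naming the coefficients turns sums, multiples and adjoints in the operator system into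
  operations on coefficients.\<close>

definition op_comb ::
  "nat \<Rightarrow> (nat \<Rightarrow> 'h \<Rightarrow> 'h) \<Rightarrow> complex \<Rightarrow> (nat \<Rightarrow> complex) \<Rightarrow> 'h::complex_hilbert_space \<Rightarrow> 'h" where
  "op_comb r G c d = (\<lambda>x. c *\<^sub>C x + (\<Sum>i<r. d i *\<^sub>C G i x))"

lemma op_comb_add:
  "(\<lambda>x. op_comb r G c d x + op_comb r G c' d' x) = op_comb r G (c + c') (\<lambda>i. d i + d' i)"
  by (simp add: op_comb_def fun_eq_iff scaleC_add_left sum.distrib)

lemma op_comb_scaleC:
  "(\<lambda>x. b *\<^sub>C op_comb r G c d x) = op_comb r G (b * c) (\<lambda>i. b * d i)"
  by (simp add: op_comb_def fun_eq_iff scaleC_add_right scaleC_sum_right scaleC_scaleC)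

lemma op_comb_id: "op_comb r G 1 (\<lambda>_. 0) = id"
  by (simp add: op_comb_def fun_eq_iff)

lemma op_comb_gen:
  assumes "k < r"
  shows "op_comb r G 0 (\<lambda>i. if i = k then 1 else 0) = G k"
proof
  fix x
  have "(\<Sum>i<r. (if i = k then 1 else 0) *\<^sub>C G i x) = (\<Sum>i<r. if i = k then G i x else 0)"
    by (rule sum.cong) auto
  then show "op_comb r G 0 (\<lambda>i. if i = k then 1 else 0) x = G k x"
    using assms by (simp add: op_comb_def)
qed

lemma bounded_linear_op_comb:
  assumes "\<And>i. i < r \<Longrightarrow> bounded_linear (G i)"
  shows "bounded_linear (op_comb r G c d)"
  unfolding op_comb_def
  by (intro bounded_linear_add bounded_linear_scaleC bounded_linear_sum
      bounded_linear_compose[OF bounded_linear_scaleC]) (use assms in auto)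

text \<open>With self-adjoint generators, taking adjoints only conjugates coefficients; this is what
  makes the span closed under adjoints.\<close>

lemma cinner_op_comb:
  assumes "\<And>i. i < r \<Longrightarrow> selfadjoint_op (G i)"
  shows "cinner (op_comb r G c d x) y = cinner x (op_comb r G (cnj c) (\<lambda>i. cnj (d i)) y)"
  using assms
  by (simp add: op_comb_def cinner_add_left cinner_add_right cinner_sum_left cinner_sum_right
      cinner_scaleC_left cinner_scaleC_right selfadjoint_op_def)

text \<open>With t = \<open>onorm T\<close> the form is t(|x_0|^2 + |x_1|^2) + 2 Re <T x_1, x_0>.
  Its cross term is at least -2t |x_0| |x_1|, hence at least -t(|x_0|^2 + |x_1|^2).\<close>

lemma pos_op_matrix_onorm:
  fixes T :: "'h::complex_hilbert_space \<Rightarrow> 'h"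
  assumes "bounded_linear T" and adj: "\<And>x y. cinner (T x) y = cinner x (T' y)"
  defines "I \<equiv> \<lambda>x. of_real (onorm T) *\<^sub>C x"
  shows "pos_op_matrix 2 (\<lambda>i j. if i = j then I else if i = 0 then T else T')"
  unfolding pos_op_matrix_def
proof
  fix x :: "nat \<Rightarrow> 'h"
  let ?t = "onorm T"
  have "\<bar>Re (cinner (T (x 1)) (x 0))\<bar> \<le> norm (T (x 1)) * norm (x 0)"
    using Cauchy_Schwarz_ineq2 inner_eq_Re_cinner by metis
  also have "\<dots> \<le> ?t * norm (x 1) * norm (x 0)"
    by (intro mult_right_mono onorm assms(1)) auto
  finally have "\<bar>Re (cinner (T (x 1)) (x 0))\<bar> \<le> ?t * (norm (x 1) * norm (x 0))"
    by (simp add: mult.assoc)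
  moreover have "2 * (norm (x 1) * norm (x 0)) \<le> (norm (x 0))\<^sup>2 + (norm (x 1))\<^sup>2"
    using sum_squares_bound[of "norm (x 1)" "norm (x 0)"] by simp
  then have "?t * (2 * (norm (x 1) * norm (x 0))) \<le> ?t * ((norm (x 0))\<^sup>2 + (norm (x 1))\<^sup>2)"
    by (intro mult_left_mono onorm_pos_le assms(1))
  ultimately have "0 \<le> ?t * ((norm (x 0))\<^sup>2 + (norm (x 1))\<^sup>2) + 2 * Re (cinner (T (x 1)) (x 0))"
    by (simp add: abs_le_iff algebra_simps)
  \<comment> \<open>In the order on complex numbers \<open>0 \<le> z\<close> includes that z is
    real; the two off-diagonal terms are conjugate, so their sum is.\<close>
  moreover have "cinner (T' (x 0)) (x 1) = cnj (cinner (T (x 1)) (x 0))"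
    by (metis adj cinner_commute)
  ultimately show "0 \<le> (\<Sum>i<2. \<Sum>j<2.
      cinner ((if i = j then I else if i = 0 then T else T') (x j)) (x i))"
    by (simp add: numeral_2_eq_2 I_def cinner_scaleC_left cinner_self less_eq_complex_def
        algebra_simps)
qed

section \<open>Matrices and their sesquilinear forms\<close>

lemma mat_adjoint_carrier [simp]: "V \<in> carrier_mat n m \<Longrightarrow> mat_adjoint V \<in> carrier_mat m n"
  by (rule carrier_matI) (simp_all add: mat_adjoint_def)

lemma mat_adjoint_index:
  "i < dim_col V \<Longrightarrow> j < dim_row V \<Longrightarrow> mat_adjoint V $$ (i, j) = conjugate (V $$ (j, i))"
  by (simp add: mat_adjoint_def mat_of_rows_index)

lemma compress_mat_carrier [simp]:
  "V \<in> carrier_mat n m \<Longrightarrow> compress_mat V M \<in> carrier_mat m m"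
  by (rule carrier_matI) (simp_all add: compress_mat_def mat_adjoint_def)

lemma mat_sum_carrier [simp]: "mat_sum n f I \<in> carrier_mat n n"
  by (simp add: mat_sum_def)

lemma mat_eval_carrier [simp]: "mat_eval n p X \<in> carrier_mat n n"
  by (simp add: mat_eval_def)

lemma form_entries:
  fixes M :: "complex mat"
  assumes M: "M \<in> carrier_mat n m" and v: "v \<in> carrier_vec m" and w: "w \<in> carrier_vec n"
  shows "(M *\<^sub>v v) \<bullet>c w = (\<Sum>a<n. \<Sum>b<m. M $$ (a, b) * v $ b * cnj (w $ a))"
proof -
  have "(M *\<^sub>v v) $ a = (\<Sum>b<m. M $$ (a, b) * v $ b)" if "a < n" for a
    using M v that by (simp add: scalar_prod_def atLeast0LessThan)
  moreover have "(M *\<^sub>v v) \<bullet>c w = (\<Sum>a<n. (M *\<^sub>v v) $ a * cnj (w $ a))"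
    using w by (simp add: scalar_prod_def atLeast0LessThan)
  ultimately show ?thesis
    by (simp add: sum_distrib_right)
qed

lemma form_add:
  fixes M N :: "complex mat"
  assumes M: "M \<in> carrier_mat n m" and N: "N \<in> carrier_mat n m"
    and vw: "v \<in> carrier_vec m" "w \<in> carrier_vec n"
  shows "((M + N) *\<^sub>v v) \<bullet>c w = (M *\<^sub>v v) \<bullet>c w + (N *\<^sub>v v) \<bullet>c w"
proof -
  have "(M + N) $$ (a, b) = M $$ (a, b) + N $$ (a, b)" if "a < n" "b < m" for a b
    using M N that by auto
  then show ?thesis
    by (simp add: form_entries[OF M vw] form_entries[OF N vw] form_entries[OF add_carrier_mat[OF N] vw]
        distrib_right sum.distrib)
qed

lemma form_smult:
  fixes M :: "complex mat"
  assumes M: "M \<in> carrier_mat n m" and vw: "v \<in> carrier_vec m" "w \<in> carrier_vec n"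
  shows "((c \<cdot>\<^sub>m M) *\<^sub>v v) \<bullet>c w = c * ((M *\<^sub>v v) \<bullet>c w)"
proof -
  have "(c \<cdot>\<^sub>m M) $$ (a, b) = c * M $$ (a, b)" if "a < n" "b < m" for a b
    using M that by auto
  then show ?thesis
    by (simp add: form_entries[OF M vw] form_entries[OF smult_carrier_mat[OF M] vw]
        sum_distrib_left mult.assoc)
qed

lemma form_minus:
  fixes M N :: "complex mat"
  assumes M: "M \<in> carrier_mat n m" and N: "N \<in> carrier_mat n m"
    and vw: "v \<in> carrier_vec m" "w \<in> carrier_vec n"
  shows "((M - N) *\<^sub>v v) \<bullet>c w = (M *\<^sub>v v) \<bullet>c w - (N *\<^sub>v v) \<bullet>c w"
proof -
  have "(M - N) $$ (a, b) = M $$ (a, b) - N $$ (a, b)" if "a < n" "b < m" for a b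
    using M N that by auto
  then show ?thesis
    by (simp add: form_entries[OF M vw] form_entries[OF N vw]
        form_entries[OF minus_carrier_mat[OF N] vw] left_diff_distrib sum_subtractf)
qed

lemma form_mat_sum:
  assumes "\<And>i. i \<in> I \<Longrightarrow> f i \<in> carrier_mat n n" "v \<in> carrier_vec n" "w \<in> carrier_vec n"
  shows "(mat_sum n f I *\<^sub>v v) \<bullet>c w = (\<Sum>i\<in>I. (f i *\<^sub>v v) \<bullet>c w)"
proof -
  have "(mat_sum n f I *\<^sub>v v) \<bullet>c w
      = (\<Sum>a<n. \<Sum>b<n. \<Sum>i\<in>I. f i $$ (a, b) * v $ b * cnj (w $ a))"
    unfolding form_entries[OF mat_sum_carrier assms(2,3)]
    by (simp add: mat_sum_def sum_distrib_right)
  also have "\<dots> = (\<Sum>a<n. \<Sum>i\<in>I. \<Sum>b<n. f i $$ (a, b) * v $ b * cnj (w $ a))"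
    by (intro sum.cong refl sum.swap)
  also have "\<dots> = (\<Sum>i\<in>I. \<Sum>a<n. \<Sum>b<n. f i $$ (a, b) * v $ b * cnj (w $ a))"
    by (rule sum.swap)
  finally show ?thesis
    by (simp only: form_entries[OF assms(1) assms(2,3)] cong: sum.cong)
qed

lemma form_adjoint:
  fixes V :: "complex mat"
  assumes V: "V \<in> carrier_mat n m" and v: "v \<in> carrier_vec n" and w: "w \<in> carrier_vec m"
  shows "(mat_adjoint V *\<^sub>v v) \<bullet>c w = v \<bullet>c (V *\<^sub>v w)"
proof -
  have entry: "mat_adjoint V $$ (a, b) = cnj (V $$ (b, a))" if "a < m" "b < n" for a b
    using V that by (simp add: mat_adjoint_index)
  have Vw: "(V *\<^sub>v w) $ b = (\<Sum>a<m. V $$ (b, a) * w $ a)" if "b < n" for b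
    using V w that by (simp add: scalar_prod_def atLeast0LessThan)
  have "(mat_adjoint V *\<^sub>v v) \<bullet>c w = (\<Sum>a<m. \<Sum>b<n. cnj (V $$ (b, a)) * v $ b * cnj (w $ a))"
    by (simp add: form_entries[OF mat_adjoint_carrier[OF V] v w] entry)
  also have "\<dots> = (\<Sum>b<n. \<Sum>a<m. cnj (V $$ (b, a)) * v $ b * cnj (w $ a))"
    by (rule sum.swap)
  also have "\<dots> = (\<Sum>b<n. v $ b * cnj ((V *\<^sub>v w) $ b))"
    by (intro sum.cong) (simp_all add: Vw sum_distrib_left mult_ac)
  also have "\<dots> = v \<bullet>c (V *\<^sub>v w)"
    using V by (simp add: scalar_prod_def atLeast0LessThan)
  finally show ?thesis .
qed

text \<open>Compression substitutes Vv and Vw for v and w. Hence it respects linear operations, and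
  it preserves complete positivity.\<close>

lemma form_compress:
  assumes "V \<in> carrier_mat n m" "M \<in> carrier_mat n n" "v \<in> carrier_vec m" "w \<in> carrier_vec m"
  shows "(compress_mat V M *\<^sub>v v) \<bullet>c w = (M *\<^sub>v (V *\<^sub>v v)) \<bullet>c (V *\<^sub>v w)"
proof -
  have "compress_mat V M *\<^sub>v v = mat_adjoint V *\<^sub>v (M *\<^sub>v (V *\<^sub>v v))"
    using assms unfolding compress_mat_def
    by (simp add: assoc_mult_mat_vec[of _ m n] assoc_mult_mat_vec[of _ n n] assoc_mult_mat_vec[of _ m n _ m]
        assoc_mult_mat[of _ m n _ n _ m])
  then show ?thesis
    using assms by (simp add: form_adjoint[of V n m])
qed

text \<open>Entries are values of the form at unit vectors. Identities between compressions and for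
  adjoints can thus be checked on forms, with no reassociation of matrix products.\<close>

lemma mat_eq_form:
  fixes M N :: "complex mat"
  assumes "M \<in> carrier_mat n m" "N \<in> carrier_mat n m"
    and eq: "\<And>v w. v \<in> carrier_vec m \<Longrightarrow> w \<in> carrier_vec n \<Longrightarrow> (M *\<^sub>v v) \<bullet>c w = (N *\<^sub>v v) \<bullet>c w"
  shows "M = N"
proof (rule eq_matI)
  have entry: "(P *\<^sub>v unit_vec m b) \<bullet>c unit_vec n a = P $$ (a, b)"
    if "P \<in> carrier_mat n m" "a < n" "b < m" for P :: "complex mat" and a b
  proof -
    have "conjugate (unit_vec n a) = (unit_vec n a :: complex vec)"
      by (rule eq_vecI) (auto simp: unit_vec_def)
    moreover have "(P *\<^sub>v unit_vec m b) $ a = P $$ (a, b)"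
      using that by (auto simp: scalar_prod_right_unit)
    ultimately show ?thesis
      using that scalar_prod_right_unit[of a n "P *\<^sub>v unit_vec m b"] by auto
  qed
  fix a b assume "a < dim_row N" "b < dim_col N"
  then show "M $$ (a, b) = N $$ (a, b)"
    using entry[of M a b] entry[of N a b] eq[of "unit_vec m b" "unit_vec n a"] assms(1,2) by auto
qed (use assms in auto)

lemma compress_mat_add:
  assumes V: "V \<in> carrier_mat n m" and M: "M \<in> carrier_mat n n" and N: "N \<in> carrier_mat n n"
  shows "compress_mat V (M + N) = (compress_mat V M + compress_mat V N)"
proof (rule mat_eq_form[of _ m m])
  fix v w :: "complex vec" assume vw: "v \<in> carrier_vec m" "w \<in> carrier_vec m"
  note C = compress_mat_carrier[OF V]
  have Vvw: "V *\<^sub>v v \<in> carrier_vec n" "V *\<^sub>v w \<in> carrier_vec n"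
    using V vw by auto
  show "(compress_mat V (M + N) *\<^sub>v v) \<bullet>c w = ((compress_mat V M + compress_mat V N) *\<^sub>v v) \<bullet>c w"
    by (simp only: form_compress[OF V add_carrier_mat[OF N] vw] form_add[OF M N Vvw]
        form_add[OF C C vw] form_compress[OF V M vw] form_compress[OF V N vw])
qed (rule compress_mat_carrier[OF V] add_carrier_mat)+

lemma compress_mat_smult:
  assumes V: "V \<in> carrier_mat n m" and M: "M \<in> carrier_mat n n"
  shows "compress_mat V (c \<cdot>\<^sub>m M) = (c \<cdot>\<^sub>m compress_mat V M)"
proof (rule mat_eq_form[of _ m m])
  fix v w :: "complex vec" assume vw: "v \<in> carrier_vec m" "w \<in> carrier_vec m"
  note C = compress_mat_carrier[OF V]
  have Vvw: "V *\<^sub>v v \<in> carrier_vec n" "V *\<^sub>v w \<in> carrier_vec n"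
    using V vw by auto
  show "(compress_mat V (c \<cdot>\<^sub>m M) *\<^sub>v v) \<bullet>c w = ((c \<cdot>\<^sub>m compress_mat V M) *\<^sub>v v) \<bullet>c w"
    by (simp only: form_compress[OF V smult_carrier_mat[OF M] vw] form_smult[OF M Vvw]
        form_smult[OF C vw] form_compress[OF V M vw])
qed (rule compress_mat_carrier[OF V] smult_carrier_mat)+

lemma compress_mat_sum:
  assumes V: "V \<in> carrier_mat n m" and f: "\<And>i. i \<in> I \<Longrightarrow> f i \<in> carrier_mat n n"
  shows "compress_mat V (mat_sum n f I) = mat_sum m (\<lambda>i. compress_mat V (f i)) I"
proof (rule mat_eq_form[of _ m m])
  fix v w :: "complex vec" assume vw: "v \<in> carrier_vec m" "w \<in> carrier_vec m"
  note C = compress_mat_carrier[OF V]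
  have Vvw: "V *\<^sub>v v \<in> carrier_vec n" "V *\<^sub>v w \<in> carrier_vec n"
    using V vw by auto
  show "(compress_mat V (mat_sum n f I) *\<^sub>v v) \<bullet>c w = (mat_sum m (\<lambda>i. compress_mat V (f i)) I *\<^sub>v v) \<bullet>c w"
    by (simp only: form_compress[OF V mat_sum_carrier vw] form_mat_sum[OF f Vvw]
        form_mat_sum[OF C vw] form_compress[OF V f vw] cong: sum.cong)
qed (rule compress_mat_carrier[OF V] mat_sum_carrier)+

lemma compress_mat_one: "isometry_mat n m V \<Longrightarrow> compress_mat V (1\<^sub>m n) = 1\<^sub>m m"
  unfolding isometry_mat_def compress_mat_def
  by (metis mat_adjoint_carrier right_mult_one_mat)

text \<open>The inserted factor U U^* equals 1. For a mere isometry V the factor V V^* is only a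
  projection, so polynomials need not commute with compression; this is why \<Gamma>-pairs are
  singled out.\<close>

lemma compress_mat_mult:
  assumes "unitary_mat n U" and M: "M \<in> carrier_mat n n" and N: "N \<in> carrier_mat n n"
  shows "compress_mat U (M * N) = compress_mat U M * compress_mat U N"
proof -
  let ?W = "mat_adjoint U"
  have U: "U \<in> carrier_mat n n" and W: "?W \<in> carrier_mat n n" and UW: "U * ?W = 1\<^sub>m n"
    using assms by (auto simp: unitary_mat_def)
  note carriers = mult_carrier_mat[OF W M] mult_carrier_mat[OF N U]
  have "?W * M * U * (?W * N * U) = ?W * M * (U * ?W * (N * U))"
    by (simp only: assoc_mult_mat[OF carriers(1) U mult_carrier_mat[OF W carriers(2)]]
        assoc_mult_mat[OF W N U] assoc_mult_mat[OF U W carriers(2)])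
  also have "\<dots> = ?W * (M * N) * U"
    by (simp only: UW left_mult_one_mat[OF carriers(2)] assoc_mult_mat[OF carriers(1) N U, symmetric]
        assoc_mult_mat[OF W M N])
  finally show ?thesis by (simp add: compress_mat_def)
qed

lemma unitary_isometry: "unitary_mat n U \<Longrightarrow> isometry_mat n n U"
  by (simp add: unitary_mat_def isometry_mat_def)

text \<open>Turns the sum of squares in \<open>bounded_graded\<close> into a sum of squared lengths,
  to which a norm bound applies.\<close>

lemma form_selfadjoint_square:
  assumes "M \<in> selfadjoint_mats n" "v \<in> carrier_vec n"
  shows "((M * M) *\<^sub>v v) \<bullet>c v = (M *\<^sub>v v) \<bullet>c (M *\<^sub>v v)"
proof -
  have M: "M \<in> carrier_mat n n" "mat_adjoint M = M"
    using assms by (auto simp: selfadjoint_mats_def)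
  have "((M * M) *\<^sub>v v) \<bullet>c v = (M *\<^sub>v (M *\<^sub>v v)) \<bullet>c v"
    using M(1) assms(2) by simp
  also have "\<dots> = (M *\<^sub>v v) \<bullet>c (M *\<^sub>v v)"
    using form_adjoint[of M n n "M *\<^sub>v v" v] M assms(2) by simp
  finally show ?thesis .
qed

lemma vec_norm2_nonneg: "0 \<le> vec_norm2 v"
  using conjugate_square_ge_0_vec[of v] by (simp add: vec_norm2_def less_eq_complex_def)

lemma cscalar_prod_self: "v \<bullet>c v = complex_of_real ((vec_norm2 v)\<^sup>2)"
  using conjugate_square_ge_0_vec[of v]
  by (simp add: vec_norm2_def less_eq_complex_def complex_eq_iff)

subsection \<open>Direct sums\<close>

lemma dsum_mat_carrier [simp]:
  "M \<in> carrier_mat n n \<Longrightarrow> N \<in> carrier_mat m m \<Longrightarrow> dsum_mat n m M N \<in> carrier_mat (n + m) (n + m)"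
  by (simp add: dsum_mat_def)

lemma dsum_mat_one: "dsum_mat n m (1\<^sub>m n) (1\<^sub>m m) = 1\<^sub>m (n + m)"
  by (simp add: dsum_mat_def)

lemma dsum_mat_add:
  assumes "M \<in> carrier_mat n n" "M' \<in> carrier_mat n n" "N \<in> carrier_mat m m" "N' \<in> carrier_mat m m"
  shows "dsum_mat n m (M + M') (N + N') = dsum_mat n m M N + dsum_mat n m M' N'"
  by (rule eq_matI) (use assms in \<open>auto simp: dsum_mat_def\<close>)

lemma dsum_mat_smult:
  assumes "M \<in> carrier_mat n n" "N \<in> carrier_mat m m"
  shows "dsum_mat n m (c \<cdot>\<^sub>m M) (c \<cdot>\<^sub>m N) = c \<cdot>\<^sub>m dsum_mat n m M N"
  by (rule eq_matI) (use assms in \<open>auto simp: dsum_mat_def\<close>)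

lemma dsum_mat_mult:
  assumes "M \<in> carrier_mat n n" "M' \<in> carrier_mat n n" "N \<in> carrier_mat m m" "N' \<in> carrier_mat m m"
  shows "dsum_mat n m (M * M') (N * N') = dsum_mat n m M N * dsum_mat n m M' N'"
  using assms unfolding dsum_mat_def
  by (subst mult_four_block_mat[where ?nr1.0 = n and ?n1.0 = n and ?n2.0 = m and ?nr2.0 = m
        and ?nc1.0 = n and ?nc2.0 = m]) auto

lemma dsum_mat_sum:
  assumes "\<And>i. i \<in> I \<Longrightarrow> f i \<in> carrier_mat n n" "\<And>i. i \<in> I \<Longrightarrow> h i \<in> carrier_mat m m"
  shows "dsum_mat n m (mat_sum n f I) (mat_sum m h I) = mat_sum (n + m) (\<lambda>i. dsum_mat n m (f i) (h i)) I"
proof (rule eq_matI)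
  fix a b
  assume "a < dim_row (mat_sum (n + m) (\<lambda>i. dsum_mat n m (f i) (h i)) I)"
    "b < dim_col (mat_sum (n + m) (\<lambda>i. dsum_mat n m (f i) (h i)) I)"
  then have "a < n + m" "b < n + m" by (auto simp: mat_sum_def)
  moreover have "dim_row (f i) = n" "dim_col (f i) = n" "dim_row (h i) = m" "dim_col (h i) = m"
    if "i \<in> I" for i
    using assms[OF that] by auto
  ultimately show "dsum_mat n m (mat_sum n f I) (mat_sum m h I) $$ (a, b)
      = mat_sum (n + m) (\<lambda>i. dsum_mat n m (f i) (h i)) I $$ (a, b)"
    by (auto simp: mat_sum_def dsum_mat_def intro!: sum.cong)
qed (auto simp: mat_sum_def dsum_mat_def)

text \<open>Each block sees only its own part of the vectors, so complete positivity of two maps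
  passes to their direct sum.\<close>

lemma form_dsum:
  assumes M: "M \<in> carrier_mat n n" and N: "N \<in> carrier_mat m m"
    and v: "v \<in> carrier_vec (n + m)" and w: "w \<in> carrier_vec (n + m)"
  shows "(dsum_mat n m M N *\<^sub>v v) \<bullet>c w
    = (M *\<^sub>v vec_first v n) \<bullet>c vec_first w n + (N *\<^sub>v vec_last v m) \<bullet>c vec_last w m"
proof -
  have split: "(\<Sum>a<n + m. F a) = (\<Sum>a<n. F a) + (\<Sum>a<m. F (n + a))" for F :: "nat \<Rightarrow> complex"
    by (induction m) (auto simp: add.assoc)
  show ?thesis
    using v w M N form_entries[OF dsum_mat_carrier[OF M N] v w]
      form_entries[OF M, of "vec_first v n" "vec_first w n"]
      form_entries[OF N, of "vec_last v m" "vec_last w m"]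
    by (simp add: split vec_first_def vec_last_def dsum_mat_def)
qed

section \<open>Noncommutative polynomials in matrices\<close>

lemma mat_word_carrier:
  assumes "\<And>j. j < g \<Longrightarrow> X j \<in> carrier_mat n n" "w \<in> lists {..<g}"
  shows "mat_word n X w \<in> carrier_mat n n"
  using assms(2) by (induction w) (auto intro!: mult_carrier_mat assms(1))

lemma nc_polys_words: "p \<in> nc_polys g \<Longrightarrow> w \<in> Poly_Mapping.keys p \<Longrightarrow> w \<in> lists {..<g}"
  by (auto simp: nc_polys_def)

lemma mat_sum_cong:
  assumes "\<And>i. i \<in> I \<Longrightarrow> f i = h i"
  shows "mat_sum n f I = mat_sum n h I"
  using assms by (simp add: mat_sum_def cong: sum.cong)

lemma mat_sum_lessThan_Suc:
  assumes "f k \<in> carrier_mat n n"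
  shows "mat_sum n f {..<Suc k} = mat_sum n f {..<k} + f k"
  by (rule eq_matI) (use carrier_matD[OF assms] in \<open>auto simp: mat_sum_def\<close>)

lemma mat_word_compress:
  assumes U: "unitary_mat n U" and X: "\<And>j. j < g \<Longrightarrow> X j \<in> carrier_mat n n"
    and w: "w \<in> lists {..<g}"
  shows "mat_word n (compress_tuple g U X) w = compress_mat U (mat_word n X w)"
  using w
proof (induction w)
  case Nil
  show ?case by (simp add: compress_mat_one[OF unitary_isometry[OF U]])
next
  case (Cons j w)
  then show ?case
    using compress_mat_mult[OF U X mat_word_carrier[OF X]] by (simp add: compress_tuple_def)
qed

lemma mat_eval_compress:
  assumes U: "unitary_mat n U" and X: "\<And>j. j < g \<Longrightarrow> X j \<in> carrier_mat n n" and p: "p \<in> nc_polys g"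
  shows "mat_eval n p (compress_tuple g U X) = compress_mat U (mat_eval n p X)"
proof -
  have Uc: "U \<in> carrier_mat n n" using U by (simp add: unitary_mat_def)
  note words = nc_polys_words[OF p]
  have "compress_mat U (mat_eval n p X) = mat_sum n
      (\<lambda>w. compress_mat U (Poly_Mapping.lookup p w \<cdot>\<^sub>m mat_word n X w)) (Poly_Mapping.keys p)"
    unfolding mat_eval_def
    by (rule compress_mat_sum[OF Uc]) (rule smult_carrier_mat[OF mat_word_carrier[OF X words]])
  also have "\<dots> = mat_eval n p (compress_tuple g U X)"
    unfolding mat_eval_def
    by (rule mat_sum_cong)
      (simp only: compress_mat_smult[OF Uc mat_word_carrier[OF X words]] mat_word_compress[OF U X words])
  finally show ?thesis by simp
qed

lemma mat_word_dsum:
  assumes X: "\<And>j. j < g \<Longrightarrow> X j \<in> carrier_mat n n" and Y: "\<And>j. j < g \<Longrightarrow> Y j \<in> carrier_mat m m"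
    and w: "w \<in> lists {..<g}"
  shows "mat_word (n + m) (dsum_tuple g n m X Y) w = dsum_mat n m (mat_word n X w) (mat_word m Y w)"
  using w
proof (induction w)
  case Nil
  show ?case by (simp add: dsum_mat_one)
next
  case (Cons j w)
  then show ?case
    using dsum_mat_mult[OF X mat_word_carrier[OF X] Y mat_word_carrier[OF Y]]
    by (simp add: dsum_tuple_def)
qed

lemma mat_eval_dsum:
  assumes X: "\<And>j. j < g \<Longrightarrow> X j \<in> carrier_mat n n" and Y: "\<And>j. j < g \<Longrightarrow> Y j \<in> carrier_mat m m"
    and p: "p \<in> nc_polys g"
  shows "mat_eval (n + m) p (dsum_tuple g n m X Y) = dsum_mat n m (mat_eval n p X) (mat_eval m p Y)"
proof -
  note words = nc_polys_words[OF p]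
  note carriers = mat_word_carrier[OF X words] mat_word_carrier[OF Y words]
  have "dsum_mat n m (mat_eval n p X) (mat_eval m p Y) = mat_sum (n + m)
      (\<lambda>w. dsum_mat n m (Poly_Mapping.lookup p w \<cdot>\<^sub>m mat_word n X w)
        (Poly_Mapping.lookup p w \<cdot>\<^sub>m mat_word m Y w)) (Poly_Mapping.keys p)"
    unfolding mat_eval_def
    by (rule dsum_mat_sum; rule smult_carrier_mat; rule carriers)
  also have "\<dots> = mat_eval (n + m) p (dsum_tuple g n m X Y)"
    unfolding mat_eval_def
    by (rule mat_sum_cong) (simp only: dsum_mat_smult[OF carriers] mat_word_dsum[OF X Y words])
  finally show ?thesis by simp
qed

section \<open>Topologies of matrices and of tuples\<close>

lemma topspace_mat_topology [simp]: "topspace (mat_topology n) = carrier_mat n n"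
  by (auto simp: mat_topology_def topspace_pullback_topology)

text \<open>The topology is pulled back from a product, so continuity can be tested entry by entry.
  The carrier condition is there because the type contains matrices of all sizes.\<close>

lemma continuous_map_mat_topology:
  "continuous_map X (mat_topology n) f \<longleftrightarrow>
     (\<forall>x\<in>topspace X. f x \<in> carrier_mat n n) \<and>
     (\<forall>a<n. \<forall>b<n. continuous_map X euclidean (\<lambda>x. f x $$ (a, b)))"
proof (intro iffI conjI ballI allI impI)
  assume f: "continuous_map X (mat_topology n) f"
  show "f x \<in> carrier_mat n n" if "x \<in> topspace X" for x
    using continuous_map_funspace[OF f] that by auto
  fix a b assume ab: "a < n" "b < n"
  have "continuous_map (mat_topology n) euclidean
      ((\<lambda>h. h (a, b)) \<circ> (\<lambda>M. restrict (\<lambda>ab. M $$ ab) ({..<n} \<times> {..<n})))"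
    unfolding mat_topology_def
    by (intro continuous_map_pullback continuous_map_product_projection) (use ab in auto)
  from continuous_map_compose[OF f this] ab
  show "continuous_map X euclidean (\<lambda>x. f x $$ (a, b))"
    by (simp add: comp_def)
next
  assume f: "(\<forall>x\<in>topspace X. f x \<in> carrier_mat n n) \<and>
     (\<forall>a<n. \<forall>b<n. continuous_map X euclidean (\<lambda>x. f x $$ (a, b)))"
  show "continuous_map X (mat_topology n) f"
    unfolding mat_topology_def
  proof (rule continuous_map_pullback')
    show "continuous_map X (product_topology (\<lambda>_. euclidean) ({..<n} \<times> {..<n}))
        ((\<lambda>M. restrict (\<lambda>ab. M $$ ab) ({..<n} \<times> {..<n})) \<circ> f)"
      using f by (auto simp: continuous_map_componentwise comp_def)
  qed (use f in auto)
qed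

lemma continuous_map_cmult:
  fixes f h :: "'a \<Rightarrow> complex"
  assumes "continuous_map X euclidean f" "continuous_map X euclidean h"
  shows "continuous_map X euclidean (\<lambda>x. f x * h x)"
  using assms by (auto simp: continuous_map_atin intro: tendsto_mult)

lemma continuous_map_csum:
  fixes f :: "'i \<Rightarrow> 'a \<Rightarrow> complex"
  assumes "\<And>i. i \<in> I \<Longrightarrow> continuous_map X euclidean (f i)"
  shows "continuous_map X euclidean (\<lambda>x. \<Sum>i\<in>I. f i x)"
  using assms by (auto simp: continuous_map_atin intro: tendsto_sum)

lemma continuous_map_mat_mult:
  assumes "continuous_map X (mat_topology n) f" "continuous_map X (mat_topology n) h"
  shows "continuous_map X (mat_topology n) (\<lambda>x. f x * h x)"
  unfolding continuous_map_mat_topology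
proof (intro conjI ballI allI impI)
  note F = assms[unfolded continuous_map_mat_topology]
  show "f x * h x \<in> carrier_mat n n" if "x \<in> topspace X" for x
    using F that by auto
  fix a b assume ab: "a < n" "b < n"
  have "continuous_map X euclidean (\<lambda>x. \<Sum>k<n. f x $$ (a, k) * h x $$ (k, b))"
    by (intro continuous_map_csum continuous_map_cmult) (use F ab in auto)
  \<comment> \<open>The entry formula is available only on the topspace, where the sizes are known;
    hence \<open>continuous_map_eq\<close> below.\<close>
  moreover have "(\<Sum>k<n. f x $$ (a, k) * h x $$ (k, b)) = (f x * h x) $$ (a, b)"
    if "x \<in> topspace X" for x
  proof -
    have "f x \<in> carrier_mat n n" "h x \<in> carrier_mat n n" using F that by auto
    then show ?thesis using ab by (auto simp: scalar_prod_def atLeast0LessThan)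
  qed
  ultimately show "continuous_map X euclidean (\<lambda>x. (f x * h x) $$ (a, b))"
    by (rule continuous_map_eq) auto
qed

lemma continuous_map_mat_sum:
  assumes "\<And>i. i \<in> I \<Longrightarrow> continuous_map X (mat_topology n) (f i)"
  shows "continuous_map X (mat_topology n) (\<lambda>x. mat_sum n (\<lambda>i. f i x) I)"
  unfolding continuous_map_mat_topology
proof (intro conjI ballI allI impI)
  fix a b assume ab: "a < n" "b < n"
  have "continuous_map X euclidean (\<lambda>x. \<Sum>i\<in>I. f i x $$ (a, b))"
    using assms ab by (intro continuous_map_csum) (auto simp: continuous_map_mat_topology)
  then show "continuous_map X euclidean (\<lambda>x. mat_sum n (\<lambda>i. f i x) I $$ (a, b))"
    using ab by (simp add: mat_sum_def)
qed auto

lemma continuous_map_mat_smult: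
  assumes "continuous_map X (mat_topology n) f"
  shows "continuous_map X (mat_topology n) (\<lambda>x. c \<cdot>\<^sub>m f x)"
  unfolding continuous_map_mat_topology
proof (intro conjI ballI allI impI)
  note F = assms[unfolded continuous_map_mat_topology]
  show "c \<cdot>\<^sub>m f x \<in> carrier_mat n n" if "x \<in> topspace X" for x
    using F that by auto
  fix a b assume ab: "a < n" "b < n"
  have "continuous_map X euclidean (\<lambda>x. c * f x $$ (a, b))"
    using F ab by (intro continuous_map_cmult) auto
  moreover have "c * f x $$ (a, b) = (c \<cdot>\<^sub>m f x) $$ (a, b)" if "x \<in> topspace X" for x
    using F that ab by auto
  ultimately show "continuous_map X euclidean (\<lambda>x. (c \<cdot>\<^sub>m f x) $$ (a, b))"
    by (rule continuous_map_eq) auto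
qed

lemma continuous_map_mat_add:
  assumes "continuous_map X (mat_topology n) f" "continuous_map X (mat_topology n) h"
  shows "continuous_map X (mat_topology n) (\<lambda>x. f x + h x)"
  unfolding continuous_map_mat_topology
proof (intro conjI ballI allI impI)
  note F = assms[unfolded continuous_map_mat_topology]
  show "f x + h x \<in> carrier_mat n n" if "x \<in> topspace X" for x
    using F that by auto
  fix a b assume ab: "a < n" "b < n"
  have "continuous_map X euclidean (\<lambda>x. f x $$ (a, b) + h x $$ (a, b))"
    using F ab by (intro continuous_map_add) auto
  moreover have "f x $$ (a, b) + h x $$ (a, b) = (f x + h x) $$ (a, b)" if "x \<in> topspace X" for x
  proof -
    have "f x \<in> carrier_mat n n" "h x \<in> carrier_mat n n" using F that by auto
    then show ?thesis using ab by auto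
  qed
  ultimately show "continuous_map X euclidean (\<lambda>x. (f x + h x) $$ (a, b))"
    by (rule continuous_map_eq) auto
qed

lemma continuous_map_mat_const:
  "M \<in> carrier_mat n n \<Longrightarrow> continuous_map X (mat_topology n) (\<lambda>_. M)"
  by (simp add: continuous_map_const)

lemma continuous_map_mat_word:
  assumes "\<And>j. j < g \<Longrightarrow> continuous_map X (mat_topology n) (\<lambda>x. f x j)" and "w \<in> lists {..<g}"
  shows "continuous_map X (mat_topology n) (\<lambda>x. mat_word n (f x) w)"
  using assms(2)
proof (induction w)
  case Nil
  show ?case by (simp add: continuous_map_mat_const)
next
  case (Cons j w)
  then show ?case by (auto intro!: continuous_map_mat_mult assms(1))
qed

lemma continuous_map_mat_eval:
  assumes "\<And>j. j < g \<Longrightarrow> continuous_map X (mat_topology n) (\<lambda>x. f x j)" and "p \<in> nc_polys g"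
  shows "continuous_map X (mat_topology n) (\<lambda>x. mat_eval n p (f x))"
  unfolding mat_eval_def
  by (intro continuous_map_mat_sum continuous_map_mat_smult
      continuous_map_mat_word[OF assms(1) nc_polys_words[OF assms(2)]])

lemma continuous_map_form:
  assumes f: "continuous_map X (mat_topology n) f" and vw: "v \<in> carrier_vec n" "w \<in> carrier_vec n"
  shows "continuous_map X euclidean (\<lambda>x. (f x *\<^sub>v v) \<bullet>c w)"
proof -
  note F = f[unfolded continuous_map_mat_topology]
  have "continuous_map X euclidean (\<lambda>x. \<Sum>a<n. \<Sum>b<n. f x $$ (a, b) * v $ b * cnj (w $ a))"
    using F by (intro continuous_map_csum continuous_map_cmult) auto
  then show ?thesis
    by (rule continuous_map_eq) (use F form_entries[OF _ vw] in auto)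
qed

section \<open>Closed sets given by equations and inequalities\<close>

lemma closedin_mat_eq:
  assumes "continuous_map X (mat_topology n) f" "continuous_map X (mat_topology n) h"
  shows "closedin X {x \<in> topspace X. f x = h x}"
proof -
  note F = assms[unfolded continuous_map_mat_topology]
  have "{x \<in> topspace X. f x = h x}
      = {x \<in> topspace X. \<forall>ab\<in>{..<n} \<times> {..<n}. f x $$ ab - h x $$ ab = 0}"
  proof (intro Collect_cong conj_cong refl iffI)
    fix x assume "x \<in> topspace X" and eq: "\<forall>ab\<in>{..<n} \<times> {..<n}. f x $$ ab - h x $$ ab = 0"
    then have "f x \<in> carrier_mat n n" "h x \<in> carrier_mat n n" using F by auto
    then show "f x = h x" using eq by (intro eq_matI) auto
  qed auto
  also have "closedin X \<dots>"
  \<comment> \<open>For n = 0 there are no entries, and an intersection over the empty family would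
    be the whole type instead of the topspace.\<close>
  proof (cases "n = 0")
    case False
    have "closedin X {x \<in> topspace X. f x $$ ab - h x $$ ab \<in> {0}}" if "ab \<in> {..<n} \<times> {..<n}" for ab
      by (intro closedin_continuous_map_preimage[where Y = euclidean] continuous_map_diff)
        (use that F in auto)
    then have "closedin X (\<Inter>ab\<in>{..<n} \<times> {..<n}. {x \<in> topspace X. f x $$ ab - h x $$ ab = 0})"
      using False by (intro closedin_INT) auto
    moreover have "(\<Inter>ab\<in>{..<n} \<times> {..<n}. {x \<in> topspace X. f x $$ ab - h x $$ ab = 0})
        = {x \<in> topspace X. \<forall>ab\<in>{..<n} \<times> {..<n}. f x $$ ab - h x $$ ab = 0}"
      using False by auto
    ultimately show ?thesis by simp
  qed auto
  finally show ?thesis .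
qed

lemma closedin_nonneg:
  fixes f :: "'a \<Rightarrow> complex"
  assumes "continuous_map X euclidean f"
  shows "closedin X {x \<in> topspace X. 0 \<le> f x}"
proof -
  have "closed {z::complex. 0 \<le> Re z \<and> Im z = 0}"
    by (intro closed_Collect_conj closed_Collect_le closed_Collect_eq continuous_intros)
  moreover have "{z::complex. 0 \<le> Re z \<and> Im z = 0} = {z. 0 \<le> z}"
    by (auto simp: less_eq_complex_def)
  ultimately have "closedin X {x \<in> topspace X. f x \<in> {z. 0 \<le> z}}"
    by (intro closedin_continuous_map_preimage[OF assms]) simp
  then show ?thesis by simp
qed

text \<open>Together with \<open>closedin_Conj\<close> this reads off closedness from the shape of a
  defining formula. The index set may be infinite, as it is for complete positivity.\<close>

lemma closedin_Ball:
  assumes "\<And>i. i \<in> I \<Longrightarrow> closedin X {x \<in> topspace X. P i x}"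
  shows "closedin X {x \<in> topspace X. \<forall>i\<in>I. P i x}"
proof (cases "I = {}")
  case False
  then have "{x \<in> topspace X. \<forall>i\<in>I. P i x} = (\<Inter>i\<in>I. {x \<in> topspace X. P i x})" by auto
  then show ?thesis using assms False by (simp add: closedin_INT)
qed simp

lemma closedin_Conj:
  assumes "closedin X {x \<in> topspace X. P x}" "closedin X {x \<in> topspace X. Q x}"
  shows "closedin X {x \<in> topspace X. P x \<and> Q x}"
proof -
  have "{x \<in> topspace X. P x \<and> Q x} = {x \<in> topspace X. P x} \<inter> {x \<in> topspace X. Q x}" by auto
  then show ?thesis using assms by (simp add: closedin_Int)
qed

section \<open>Maps on the operator system\<close>

lemma linear_maps_carrier: "\<phi> \<in> linear_maps S n \<Longrightarrow> T \<in> S \<Longrightarrow> \<phi> T \<in> carrier_mat n n"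
  by (auto simp: linear_maps_def)

lemma completely_positiveD:
  assumes "completely_positive S n \<phi>" "\<And>i j. i < k \<Longrightarrow> j < k \<Longrightarrow> T i j \<in> S" "pos_op_matrix k T"
    "\<And>i. i < k \<Longrightarrow> v i \<in> carrier_vec n"
  shows "0 \<le> (\<Sum>i<k. \<Sum>j<k. (\<phi> (T i j) *\<^sub>v v j) \<bullet>c v i)"
  using assms unfolding completely_positive_def pos_mat_matrix_def by blast

text \<open>The closure properties of S keep sums and multiples inside the domain, where the
  restricted map is not \<open>undefined\<close>.\<close>

lemma linear_maps_compress:
  assumes V: "V \<in> carrier_mat n m" and \<phi>: "\<phi> \<in> linear_maps S n"
    and add: "\<And>T T'. T \<in> S \<Longrightarrow> T' \<in> S \<Longrightarrow> (\<lambda>x. T x + T' x) \<in> S"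
    and scale: "\<And>T c. T \<in> S \<Longrightarrow> (\<lambda>x. c *\<^sub>C T x) \<in> S"
  shows "compress_map S V \<phi> \<in> linear_maps S m"
  using \<phi> linear_maps_carrier[OF \<phi>] unfolding linear_maps_def compress_map_def
  by (auto simp: add scale compress_mat_add[OF V] compress_mat_smult[OF V] compress_mat_carrier[OF V])

lemma completely_positive_compress:
  assumes V: "V \<in> carrier_mat n m" and \<phi>: "\<phi> \<in> linear_maps S n" and cp: "completely_positive S n \<phi>"
  shows "completely_positive S m (compress_map S V \<phi>)"
  unfolding completely_positive_def pos_mat_matrix_def
proof (intro allI impI, elim conjE)
  fix k T and v :: "nat \<Rightarrow> complex vec"
  assume T: "\<forall>i<k. \<forall>j<k. T i j \<in> S" "pos_op_matrix k T" and v: "\<forall>i<k. v i \<in> carrier_vec m"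
  have "(compress_map S V \<phi> (T i j) *\<^sub>v v j) \<bullet>c v i = (\<phi> (T i j) *\<^sub>v (V *\<^sub>v v j)) \<bullet>c (V *\<^sub>v v i)"
    if "i < k" "j < k" for i j
    using that T v form_compress[OF V linear_maps_carrier[OF \<phi>]] by (simp add: compress_map_def)
  moreover have "0 \<le> (\<Sum>i<k. \<Sum>j<k. (\<phi> (T i j) *\<^sub>v (V *\<^sub>v v j)) \<bullet>c (V *\<^sub>v v i))"
    by (rule completely_positiveD[OF cp]) (use T v V in auto)
  ultimately show "0 \<le> (\<Sum>i<k. \<Sum>j<k. (compress_map S V \<phi> (T i j) *\<^sub>v v j) \<bullet>c v i)"
    by simp
qed

lemma linear_maps_dsum:
  assumes \<phi>: "\<phi> \<in> linear_maps S n" and \<psi>: "\<psi> \<in> linear_maps S m"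
    and add: "\<And>T T'. T \<in> S \<Longrightarrow> T' \<in> S \<Longrightarrow> (\<lambda>x. T x + T' x) \<in> S"
    and scale: "\<And>T c. T \<in> S \<Longrightarrow> (\<lambda>x. c *\<^sub>C T x) \<in> S"
  shows "dsum_map S n m \<phi> \<psi> \<in> linear_maps S (n + m)"
  using \<phi> \<psi> linear_maps_carrier[OF \<phi>] linear_maps_carrier[OF \<psi>]
  unfolding linear_maps_def dsum_map_def
  by (auto simp: add scale dsum_mat_add dsum_mat_smult)

lemma completely_positive_dsum:
  assumes \<phi>: "\<phi> \<in> linear_maps S n" "completely_positive S n \<phi>"
    and \<psi>: "\<psi> \<in> linear_maps S m" "completely_positive S m \<psi>"
  shows "completely_positive S (n + m) (dsum_map S n m \<phi> \<psi>)"
  unfolding completely_positive_def pos_mat_matrix_def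
proof (intro allI impI, elim conjE)
  fix k T and v :: "nat \<Rightarrow> complex vec"
  assume T: "\<forall>i<k. \<forall>j<k. T i j \<in> S" "pos_op_matrix k T" and v: "\<forall>i<k. v i \<in> carrier_vec (n + m)"
  let ?F = "\<lambda>i j. (\<phi> (T i j) *\<^sub>v vec_first (v j) n) \<bullet>c vec_first (v i) n"
  let ?L = "\<lambda>i j. (\<psi> (T i j) *\<^sub>v vec_last (v j) m) \<bullet>c vec_last (v i) m"
  have "(dsum_map S n m \<phi> \<psi> (T i j) *\<^sub>v v j) \<bullet>c v i = ?F i j + ?L i j" if "i < k" "j < k" for i j
    using that T v form_dsum[OF linear_maps_carrier[OF \<phi>(1)] linear_maps_carrier[OF \<psi>(1)]]
    by (simp add: dsum_map_def)
  moreover have "0 \<le> (\<Sum>i<k. \<Sum>j<k. ?F i j)"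
    by (rule completely_positiveD[OF \<phi>(2)]) (use T in auto)
  moreover have "0 \<le> (\<Sum>i<k. \<Sum>j<k. ?L i j)"
    by (rule completely_positiveD[OF \<psi>(2)]) (use T in auto)
  ultimately show "0 \<le> (\<Sum>i<k. \<Sum>j<k. (dsum_map S n m \<phi> \<psi> (T i j) *\<^sub>v v j) \<bullet>c v i)"
    by (simp add: sum.distrib)
qed

lemma closedin_linear_maps:
  assumes add: "\<And>T T'. T \<in> S \<Longrightarrow> T' \<in> S \<Longrightarrow> (\<lambda>x. T x + T' x) \<in> S"
    and scale: "\<And>T c. T \<in> S \<Longrightarrow> (\<lambda>x. c *\<^sub>C T x) \<in> S"
  shows "closedin (product_topology (\<lambda>_. mat_topology n) S) (linear_maps S n)"
proof -
  let ?P = "product_topology (\<lambda>_. mat_topology n) S"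
  have proj: "continuous_map ?P (mat_topology n) (\<lambda>\<phi>. \<phi> T)" if "T \<in> S" for T
    using that by (rule continuous_map_product_projection)
  \<comment> \<open>Writing \<open>c\<in>UNIV\<close> gives the quantifier the bounded form that
    \<open>closedin_Ball\<close> matches.\<close>
  have "closedin ?P {\<phi> \<in> topspace ?P. (\<forall>T\<in>S. \<forall>T'\<in>S. \<phi> (\<lambda>x. T x + T' x) = \<phi> T + \<phi> T') \<and>
      (\<forall>T\<in>S. \<forall>c\<in>UNIV. \<phi> (\<lambda>x. c *\<^sub>C T x) = c \<cdot>\<^sub>m \<phi> T)}"
    by (intro closedin_Conj closedin_Ball closedin_mat_eq[where n = n] continuous_map_mat_add
        continuous_map_mat_smult proj add scale)
  moreover have "{\<phi> \<in> topspace ?P. (\<forall>T\<in>S. \<forall>T'\<in>S. \<phi> (\<lambda>x. T x + T' x) = \<phi> T + \<phi> T') \<and>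
      (\<forall>T\<in>S. \<forall>c\<in>UNIV. \<phi> (\<lambda>x. c *\<^sub>C T x) = c \<cdot>\<^sub>m \<phi> T)} = linear_maps S n"
    by (auto simp: linear_maps_def)
  ultimately show ?thesis by simp
qed

text \<open>For fixed k, T and v the condition says that one finite sum of forms, continuous in
  \<phi>, is nonnegative.\<close>

lemma closedin_completely_positive:
  "closedin (product_topology (\<lambda>_. mat_topology n) S)
     {\<phi> \<in> topspace (product_topology (\<lambda>_. mat_topology n) S). completely_positive S n \<phi>}"
proof -
  let ?P = "product_topology (\<lambda>_. mat_topology n) S"
  have "closedin ?P {\<phi> \<in> topspace ?P. \<forall>k\<in>UNIV. \<forall>T\<in>{T. (\<forall>i<k. \<forall>j<k. T i j \<in> S) \<and> pos_op_matrix k T}.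
      \<forall>v\<in>{v. \<forall>i<k. v i \<in> carrier_vec n}. 0 \<le> (\<Sum>i<k. \<Sum>j<k. (\<phi> (T i j) *\<^sub>v v j) \<bullet>c v i)}"
    by (intro closedin_Ball closedin_nonneg continuous_map_csum continuous_map_form[where n = n]
        continuous_map_product_projection) auto
  moreover have "completely_positive S n \<phi> \<longleftrightarrow>
      (\<forall>k\<in>UNIV. \<forall>T\<in>{T. (\<forall>i<k. \<forall>j<k. T i j \<in> S) \<and> pos_op_matrix k T}.
        \<forall>v\<in>{v. \<forall>i<k. v i \<in> carrier_vec n}. 0 \<le> (\<Sum>i<k. \<Sum>j<k. (\<phi> (T i j) *\<^sub>v v j) \<bullet>c v i))" for \<phi>
    by (simp only: completely_positive_def pos_mat_matrix_def Ball_def mem_Collect_eq UNIV_I simp_thms)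
  ultimately show ?thesis by simp
qed

section \<open>The maps \<open>\<phi> \<mapsto> \<phi>(A)\<close>\<close>

locale gamma_tuple =
  fixes g r :: nat and \<gamma> :: "nat \<Rightarrow> ncpoly" and A :: "nat \<Rightarrow> 'h::complex_hilbert_space \<Rightarrow> 'h"
  assumes g_le_r: "g \<le> r"
    and gamma_polys: "\<And>i. i < r \<Longrightarrow> \<gamma> i \<in> nc_polys g"
    and gamma_star: "\<And>i. i < r \<Longrightarrow> nc_star (\<gamma> i) = \<gamma> i"
    and gamma_var: "\<And>j. j < g \<Longrightarrow> \<gamma> j = nc_var j"
    and A_bounded: "\<And>j. j < g \<Longrightarrow> bounded_clinear (A j)"
    and A_selfadjoint: "\<And>j. j < g \<Longrightarrow> selfadjoint_op (A j)"
begin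

section \<open>The operator system spanned by 1 and the \<gamma>_i(A)\<close>

abbreviation G :: "nat \<Rightarrow> 'h \<Rightarrow> 'h" where "G i \<equiv> op_eval (\<gamma> i) A"

abbreviation S :: "('h \<Rightarrow> 'h) set" where "S \<equiv> R_space r \<gamma> A"

lemma S_iff: "T \<in> S \<longleftrightarrow> (\<exists>c d. T = op_comb r G c d)"
  unfolding R_space_def op_comb_def by (rule mem_Collect_eq)

lemma op_comb_in_S: "op_comb r G c d \<in> S"
  using S_iff by blast

lemma S_add: "T \<in> S \<Longrightarrow> T' \<in> S \<Longrightarrow> (\<lambda>x. T x + T' x) \<in> S"
  by (auto simp: op_comb_add op_comb_in_S dest!: S_iff[THEN iffD1])

lemma S_scale: "T \<in> S \<Longrightarrow> (\<lambda>x. c *\<^sub>C T x) \<in> S"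
  by (auto simp: op_comb_scaleC op_comb_in_S dest!: S_iff[THEN iffD1])

lemma id_in_S: "id \<in> S"
  using op_comb_in_S[of 1 "\<lambda>_. 0"] by (simp add: op_comb_id)

lemma G_in_S: "i < r \<Longrightarrow> G i \<in> S"
  using op_comb_in_S[of 0 "\<lambda>k. if k = i then 1 else 0"] by (simp add: op_comb_gen)

lemma G_var: "j < g \<Longrightarrow> G j = A j"
  by (simp add: gamma_var op_eval_nc_var)

lemma A_in_S: "j < g \<Longrightarrow> A j \<in> S"
  using G_in_S[of j] G_var g_le_r by simp

lemma bounded_linear_S: "T \<in> S \<Longrightarrow> bounded_linear T"
  by (auto dest!: S_iff[THEN iffD1]
      intro!: bounded_linear_op_comb bounded_linear_op_eval[OF A_bounded gamma_polys])

lemma S_adjoint: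
  assumes "T \<in> S"
  obtains T' where "T' \<in> S" "\<And>x y. cinner (T x) y = cinner x (T' y)"
proof -
  obtain c d where T: "T = op_comb r G c d" using assms S_iff by blast
  show thesis
  proof (rule that[OF op_comb_in_S])
    show "cinner (T x) y = cinner x (op_comb r G (cnj c) (\<lambda>i. cnj (d i)) y)" for x y
      unfolding T
      by (rule cinner_op_comb) (rule selfadjoint_op_eval[OF A_selfadjoint gamma_polys gamma_star])
  qed
qed

section \<open>\<Gamma>-ucp maps are determined by their values on A\<close>

lemma UCP_linear: "\<phi> \<in> UCP g r \<gamma> A n \<Longrightarrow> \<phi> \<in> linear_maps S n"
  by (simp add: UCP_def)

lemma UCP_id: "\<phi> \<in> UCP g r \<gamma> A n \<Longrightarrow> \<phi> id = 1\<^sub>m n"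
  by (simp add: UCP_def)

lemma UCP_cp: "\<phi> \<in> UCP g r \<gamma> A n \<Longrightarrow> completely_positive S n \<phi>"
  by (simp add: UCP_def)

lemma UCP_gamma:
  "\<phi> \<in> UCP g r \<gamma> A n \<Longrightarrow> i < r \<Longrightarrow> \<phi> (G i) = mat_eval n (\<gamma> i) (map_tuple g A \<phi>)"
  by (simp add: UCP_def)

lemma UCP_I:
  assumes "\<phi> \<in> linear_maps S n" "\<phi> id = 1\<^sub>m n" "completely_positive S n \<phi>"
    and "\<And>i. i < r \<Longrightarrow> \<phi> (G i) = mat_eval n (\<gamma> i) (map_tuple g A \<phi>)"
  shows "\<phi> \<in> UCP g r \<gamma> A n"
  using assms by (simp add: UCP_def)

lemma UCP_carrier: "\<phi> \<in> UCP g r \<gamma> A n \<Longrightarrow> T \<in> S \<Longrightarrow> \<phi> T \<in> carrier_mat n n"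
  using UCP_linear linear_maps_carrier by blast

lemma map_tuple_carrier: "\<phi> \<in> UCP g r \<gamma> A n \<Longrightarrow> j < g \<Longrightarrow> map_tuple g A \<phi> j \<in> carrier_mat n n"
  using UCP_carrier[OF _ A_in_S] by (simp add: map_tuple_def)

text \<open>The value that a \<Gamma>-ucp map with \<phi>(A) = X is forced to take at
  \<open>op_comb r G c d\<close>. It is defined for every tuple X, so that it can be studied as a
  function of X.\<close>

definition eval_comb :: "nat \<Rightarrow> mtuple \<Rightarrow> complex \<Rightarrow> (nat \<Rightarrow> complex) \<Rightarrow> complex mat" where
  "eval_comb n X c d = c \<cdot>\<^sub>m 1\<^sub>m n + mat_sum n (\<lambda>i. d i \<cdot>\<^sub>m mat_eval n (\<gamma> i) X) {..<r}"

lemma UCP_op_comb: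
  assumes \<phi>: "\<phi> \<in> UCP g r \<gamma> A n"
  shows "\<phi> (op_comb r G c d) = eval_comb n (map_tuple g A \<phi>) c d"
proof -
  have add: "\<phi> (\<lambda>x. T x + T' x) = \<phi> T + \<phi> T'" if "T \<in> S" "T' \<in> S" for T T'
    using UCP_linear[OF \<phi>] that by (auto simp: linear_maps_def)
  have scale: "\<phi> (\<lambda>x. b *\<^sub>C T x) = b \<cdot>\<^sub>m \<phi> T" if "T \<in> S" for T b
    using UCP_linear[OF \<phi>] that by (auto simp: linear_maps_def)
  let ?m = "\<lambda>k. mat_sum n (\<lambda>i. d i \<cdot>\<^sub>m mat_eval n (\<gamma> i) (map_tuple g A \<phi>)) {..<k}"
  \<comment> \<open>Additivity of \<phi> applies only inside S, so membership of the partial sums is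
    carried through the induction.\<close>
  have "(\<lambda>x. \<Sum>i<k. d i *\<^sub>C G i x) \<in> S \<and> \<phi> (\<lambda>x. \<Sum>i<k. d i *\<^sub>C G i x) = ?m k" if "k \<le> r" for k
    using that
  proof (induction k)
    case 0
    \<comment> \<open>The empty sum is the zero operator, reached as a multiple of the identity so
      that homogeneity gives its value.\<close>
    have "(\<lambda>x::'h. 0 *\<^sub>C id x) \<in> S" "\<phi> (\<lambda>x. 0 *\<^sub>C id x) = 0 \<cdot>\<^sub>m 1\<^sub>m n"
      using S_scale[OF id_in_S, of 0] scale[OF id_in_S, of 0] UCP_id[OF \<phi>] by simp_all
    moreover have "0 \<cdot>\<^sub>m 1\<^sub>m n = ?m 0"
      by (rule eq_matI) (auto simp: mat_sum_def)
    ultimately show ?case by simp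
  next
    case (Suc k)
    let ?P = "\<lambda>x. \<Sum>i<k. d i *\<^sub>C G i x" and ?Q = "\<lambda>x. d k *\<^sub>C G k x"
    have P: "?P \<in> S" "\<phi> ?P = ?m k" using Suc by auto
    have Q: "?Q \<in> S" using S_scale[OF G_in_S] Suc.prems by simp
    have "\<phi> ?Q = d k \<cdot>\<^sub>m mat_eval n (\<gamma> k) (map_tuple g A \<phi>)"
      using scale[OF G_in_S] Suc.prems \<phi> by (simp add: UCP_def)
    then have "\<phi> (\<lambda>x. ?P x + ?Q x) = ?m k + d k \<cdot>\<^sub>m mat_eval n (\<gamma> k) (map_tuple g A \<phi>)"
      using add[OF P(1) Q] P(2) by simp
    also have "\<dots> = ?m (Suc k)"
      by (rule mat_sum_lessThan_Suc[symmetric]) simp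
    finally show ?case using S_add[OF P(1) Q] by simp
  qed
  from this[of r] have sum: "(\<lambda>x. \<Sum>i<r. d i *\<^sub>C G i x) \<in> S" "\<phi> (\<lambda>x. \<Sum>i<r. d i *\<^sub>C G i x) = ?m r"
    by auto
  have "\<phi> (\<lambda>x. c *\<^sub>C id x + (\<Sum>i<r. d i *\<^sub>C G i x)) = \<phi> (\<lambda>x. c *\<^sub>C id x) + ?m r"
    using add[OF S_scale[OF id_in_S] sum(1)] sum(2) by simp
  then show ?thesis
    using scale[OF id_in_S] UCP_id[OF \<phi>] by (simp add: op_comb_def eval_comb_def)
qed

section \<open>Adjoints and norms under \<Gamma>-ucp maps\<close>

lemma UCP_two_by_two:
  assumes \<phi>: "\<phi> \<in> UCP g r \<gamma> A n" and T: "T \<in> S" and T': "T' \<in> S"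
    and adj: "\<And>x y. cinner (T x) y = cinner x (T' y)"
    and a: "a \<in> carrier_vec n" and b: "b \<in> carrier_vec n"
  shows "0 \<le> of_real (onorm T * ((vec_norm2 a)\<^sup>2 + (vec_norm2 b)\<^sup>2))
    + (\<phi> T *\<^sub>v b) \<bullet>c a + (\<phi> T' *\<^sub>v a) \<bullet>c b"
proof -
  let ?t = "complex_of_real (onorm T)"
  let ?M = "\<lambda>i j. if i = j then (\<lambda>x. ?t *\<^sub>C x) else if i = (0::nat) then T else T'"
  let ?v = "\<lambda>i. if i = (0::nat) then a else b"
  have I: "(\<lambda>x. ?t *\<^sub>C x) \<in> S" using S_scale[OF id_in_S] by simp
  have "\<phi> (\<lambda>x. ?t *\<^sub>C id x) = ?t \<cdot>\<^sub>m 1\<^sub>m n"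
    using UCP_linear[OF \<phi>] UCP_id[OF \<phi>] id_in_S unfolding linear_maps_def by auto
  then have I_form: "(\<phi> (\<lambda>x. ?t *\<^sub>C x) *\<^sub>v v) \<bullet>c v = of_real (onorm T * (vec_norm2 v)\<^sup>2)"
    if "v \<in> carrier_vec n" for v
    using form_smult[OF one_carrier_mat that that] that by (simp add: cscalar_prod_self)
  have "completely_positive S n \<phi>" using \<phi> by (simp add: UCP_def)
  \<comment> \<open>This is complete positivity for k = 2, tested on the vectors a and b. The
    off-diagonal terms stay separate in the result, since it is not yet known that they are
    conjugate.\<close>
  from completely_positiveD[OF this _ pos_op_matrix_onorm[OF bounded_linear_S[OF T] adj], of ?v]
  have "0 \<le> (\<Sum>i<2. \<Sum>j<2. (\<phi> (?M i j) *\<^sub>v ?v j) \<bullet>c ?v i)"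
    using I T T' a b by simp
  then show ?thesis
    by (simp add: numeral_2_eq_2 I_form[OF a] I_form[OF b] algebra_simps)
qed

text \<open>Only the realness in \<open>UCP_two_by_two\<close> is used. Replacing v by sv turns p
  and q into cnj s p and s q, whose sum must be real: s = 1 makes the imaginary parts opposite, s =
  i makes the real parts equal.\<close>

lemma UCP_adjoint:
  assumes \<phi>: "\<phi> \<in> UCP g r \<gamma> A n" and T: "T \<in> S" and T': "T' \<in> S"
    and adj: "\<And>x y. cinner (T x) y = cinner x (T' y)"
  shows "\<phi> T' = mat_adjoint (\<phi> T)"
proof (rule mat_eq_form)
  note carriers = UCP_carrier[OF \<phi> T] UCP_carrier[OF \<phi> T']
  show "\<phi> T' \<in> carrier_mat n n" "mat_adjoint (\<phi> T) \<in> carrier_mat n n"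
    using carriers by auto
  fix v w :: "complex vec" assume v: "v \<in> carrier_vec n" and w: "w \<in> carrier_vec n"
  let ?p = "(\<phi> T *\<^sub>v w) \<bullet>c v" and ?q = "(\<phi> T' *\<^sub>v v) \<bullet>c w"
  have pos: "Im (cnj s * ?p + s * ?q) = 0" for s
  proof -
    have sv: "s \<cdot>\<^sub>v v \<in> carrier_vec n" using v by simp
    have "(\<phi> T *\<^sub>v w) \<bullet>c (s \<cdot>\<^sub>v v) = cnj s * ?p"
      using carriers(1) v w
      by (simp add: conjugate_smult_vec scalar_prod_smult_right)
    moreover have "(\<phi> T' *\<^sub>v (s \<cdot>\<^sub>v v)) \<bullet>c w = s * ?q"
      using carriers(2) v w
      by (simp add: mult_mat_vec scalar_prod_smult_left)
    ultimately show ?thesis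
      using UCP_two_by_two[OF \<phi> T T' adj sv w] by (simp add: less_eq_complex_def)
  qed
  have "?q = cnj ?p"
    using pos[of 1] pos[of \<i>] by (simp add: complex_eq_iff)
  also have "\<dots> = v \<bullet>c (\<phi> T *\<^sub>v w)"
    using carriers(1) v w
    by (simp flip: conjugate_complex_def add: conjugate_sprod_vec[of _ n] comm_scalar_prod[of _ n])
  also have "\<dots> = (mat_adjoint (\<phi> T) *\<^sub>v v) \<bullet>c w"
    using form_adjoint[OF carriers(1) v w] by simp
  finally show "?q = (mat_adjoint (\<phi> T) *\<^sub>v v) \<bullet>c w" .
qed

lemma UCP_norm_le:
  assumes \<phi>: "\<phi> \<in> UCP g r \<gamma> A n" and T: "T \<in> S" and b: "b \<in> carrier_vec n"
  shows "vec_norm2 (\<phi> T *\<^sub>v b) \<le> onorm T * vec_norm2 b"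
proof -
  obtain T' where T': "T' \<in> S" and adj: "\<And>x y. cinner (T x) y = cinner x (T' y)"
    using S_adjoint[OF T] by blast
  note M = UCP_carrier[OF \<phi> T]
  let ?t = "onorm T" and ?z = "\<phi> T *\<^sub>v b"
  have t: "0 \<le> ?t" by (rule onorm_pos_le[OF bounded_linear_S[OF T]])
  have z: "?z \<in> carrier_vec n" using M b by simp
  have quad: "0 \<le> ?t * (s\<^sup>2 * (vec_norm2 ?z)\<^sup>2 + (vec_norm2 b)\<^sup>2) - 2 * s * (vec_norm2 ?z)\<^sup>2" for s
  proof -
    \<comment> \<open>For s > 0 this vector points against \<phi>(T)b, which makes both cross terms
      nonpositive; s is left free to be optimised.\<close>
    let ?a = "complex_of_real (- s) \<cdot>\<^sub>v ?z"
    have a: "?a \<in> carrier_vec n" using z by simp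
    have za: "?z \<bullet>c ?a = of_real (- s * (vec_norm2 ?z)\<^sup>2)"
      using z by (simp add: conjugate_smult_vec scalar_prod_smult_right cscalar_prod_self)
    have az: "?a \<bullet>c ?z = of_real (- s * (vec_norm2 ?z)\<^sup>2)"
      using z by (simp add: scalar_prod_smult_left cscalar_prod_self)
    have adj_a: "(\<phi> T' *\<^sub>v ?a) \<bullet>c b = ?a \<bullet>c ?z"
      unfolding UCP_adjoint[OF \<phi> T T' adj] by (rule form_adjoint[OF M a b])
    have "?a \<bullet>c ?a = of_real (s\<^sup>2 * (vec_norm2 ?z)\<^sup>2)"
      using z by (simp add: scalar_prod_smult_left conjugate_smult_vec scalar_prod_smult_right
          cscalar_prod_self power2_eq_square)
    then have a_norm: "(vec_norm2 ?a)\<^sup>2 = s\<^sup>2 * (vec_norm2 ?z)\<^sup>2"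
      unfolding cscalar_prod_self of_real_eq_iff .
    show ?thesis
      using UCP_two_by_two[OF \<phi> T T' adj a b] unfolding adj_a az za a_norm
      by (simp add: less_eq_complex_def algebra_simps)
  qed
  have "(vec_norm2 ?z)\<^sup>2 \<le> (?t * vec_norm2 b)\<^sup>2"
  \<comment> \<open>The bound in \<open>quad\<close> is sharpest at s = 1/t. For t = 0 there is no
    minimiser, and s = 1 already forces \<phi>(T)b to have length 0.\<close>
  proof (cases "?t = 0")
    case True
    then show ?thesis using quad[of 1] by simp
  next
    case False
    \<comment> \<open>The extra factor t clears the denominators left by s = 1/t.\<close>
    have "0 \<le> ?t * (?t * ((1 / ?t)\<^sup>2 * (vec_norm2 ?z)\<^sup>2 + (vec_norm2 b)\<^sup>2)
        - 2 * (1 / ?t) * (vec_norm2 ?z)\<^sup>2)"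
      by (rule mult_nonneg_nonneg[OF t quad])
    also have "\<dots> = (?t * vec_norm2 b)\<^sup>2 - (vec_norm2 ?z)\<^sup>2"
      using False by (simp add: field_simps power2_eq_square)
    finally show ?thesis by simp
  qed
  then show ?thesis
    by (rule power2_le_imp_le) (rule mult_nonneg_nonneg[OF t vec_norm2_nonneg])
qed

lemma map_tuple_in_sa_tuples:
  assumes \<phi>: "\<phi> \<in> UCP g r \<gamma> A n"
  shows "map_tuple g A \<phi> \<in> sa_tuples g n"
proof -
  have "\<phi> (A j) \<in> selfadjoint_mats n" if "j < g" for j
  proof -
    have "cinner (A j x) y = cinner x (A j y)" for x y
      using A_selfadjoint[OF that] by (simp add: selfadjoint_op_def)
    from UCP_adjoint[OF \<phi> A_in_S[OF that] A_in_S[OF that] this, symmetric]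
    show ?thesis using UCP_carrier[OF \<phi> A_in_S[OF that]] by (simp add: selfadjoint_mats_def)
  qed
  then show ?thesis by (simp add: sa_tuples_def map_tuple_def)
qed

section \<open>Compressions and direct sums of \<Gamma>-ucp maps\<close>

lemma map_tuple_compress:
  "map_tuple g A (compress_map S V \<phi>) = compress_tuple g V (map_tuple g A \<phi>)"
  using A_in_S by (auto simp: map_tuple_def compress_tuple_def compress_map_def)

lemma map_tuple_dsum:
  "map_tuple g A (dsum_map S n m \<phi> \<psi>) = dsum_tuple g n m (map_tuple g A \<phi>) (map_tuple g A \<psi>)"
  using A_in_S by (auto simp: map_tuple_def dsum_tuple_def dsum_map_def)

text \<open>Linearity, unitality and complete positivity survive compression by any isometry; the
  \<Gamma>-pair condition supplies exactly the remaining equations for the \<gamma>_i.\<close>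

lemma compress_in_UCP:
  assumes \<phi>: "\<phi> \<in> UCP g r \<gamma> A n" and pair: "gamma_pair g r \<gamma> n m (map_tuple g A \<phi>) V"
  shows "compress_map S V \<phi> \<in> UCP g r \<gamma> A m"
proof (rule UCP_I)
  have iso: "isometry_mat n m V" using pair by (simp add: gamma_pair_def)
  then have V: "V \<in> carrier_mat n m" by (simp add: isometry_mat_def)
  show "compress_map S V \<phi> \<in> linear_maps S m"
    by (rule linear_maps_compress[OF V UCP_linear[OF \<phi>] S_add S_scale])
  show "compress_map S V \<phi> id = 1\<^sub>m m"
    using compress_mat_one[OF iso] UCP_id[OF \<phi>] id_in_S by (simp add: compress_map_def)
  show "completely_positive S m (compress_map S V \<phi>)"
    by (rule completely_positive_compress[OF V UCP_linear[OF \<phi>] UCP_cp[OF \<phi>]])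
  fix i assume i: "i < r"
  have "compress_map S V \<phi> (G i) = compress_mat V (mat_eval n (\<gamma> i) (map_tuple g A \<phi>))"
    by (simp add: compress_map_def G_in_S[OF i] UCP_gamma[OF \<phi> i])
  also have "\<dots> = mat_eval m (\<gamma> i) (compress_tuple g V (map_tuple g A \<phi>))"
    using pair i by (simp add: gamma_pair_def)
  finally show "compress_map S V \<phi> (G i) = mat_eval m (\<gamma> i) (map_tuple g A (compress_map S V \<phi>))"
    by (simp only: map_tuple_compress)
qed

text \<open>Makes closure under unitary conjugation a case of closure under \<Gamma>-pairs.\<close>

lemma gamma_pair_unitary:
  assumes "\<phi> \<in> UCP g r \<gamma> A n" "unitary_mat n U"
  shows "gamma_pair g r \<gamma> n n (map_tuple g A \<phi>) U"
  unfolding gamma_pair_def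
proof (intro conjI allI impI)
  fix i assume i: "i < r"
  have "mat_eval n (\<gamma> i) (compress_tuple g U (map_tuple g A \<phi>))
      = compress_mat U (mat_eval n (\<gamma> i) (map_tuple g A \<phi>))"
    by (rule mat_eval_compress[OF assms(2) _ gamma_polys[OF i]]) (rule map_tuple_carrier[OF assms(1)])
  then show "compress_mat U (mat_eval n (\<gamma> i) (map_tuple g A \<phi>))
      = mat_eval n (\<gamma> i) (compress_tuple g U (map_tuple g A \<phi>))" by (rule sym)
qed (rule unitary_isometry[OF assms(2)])

lemma dsum_in_UCP:
  assumes \<phi>: "\<phi> \<in> UCP g r \<gamma> A n" and \<psi>: "\<psi> \<in> UCP g r \<gamma> A m"
  shows "dsum_map S n m \<phi> \<psi> \<in> UCP g r \<gamma> A (n + m)"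
proof (rule UCP_I)
  show "dsum_map S n m \<phi> \<psi> \<in> linear_maps S (n + m)"
    by (rule linear_maps_dsum[OF UCP_linear[OF \<phi>] UCP_linear[OF \<psi>] S_add S_scale])
  show "dsum_map S n m \<phi> \<psi> id = 1\<^sub>m (n + m)"
    using dsum_mat_one UCP_id[OF \<phi>] UCP_id[OF \<psi>] id_in_S by (simp add: dsum_map_def)
  show "completely_positive S (n + m) (dsum_map S n m \<phi> \<psi>)"
    by (rule completely_positive_dsum[OF UCP_linear[OF \<phi>] UCP_cp[OF \<phi>] UCP_linear[OF \<psi>] UCP_cp[OF \<psi>]])
  fix i assume i: "i < r"
  have "dsum_map S n m \<phi> \<psi> (G i)
      = dsum_mat n m (mat_eval n (\<gamma> i) (map_tuple g A \<phi>)) (mat_eval m (\<gamma> i) (map_tuple g A \<psi>))"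
    by (simp add: dsum_map_def G_in_S[OF i] UCP_gamma[OF \<phi> i] UCP_gamma[OF \<psi> i])
  also have "\<dots> = mat_eval (n + m) (\<gamma> i) (dsum_tuple g n m (map_tuple g A \<phi>) (map_tuple g A \<psi>))"
    by (rule mat_eval_dsum[OF _ _ gamma_polys[OF i], symmetric])
      (rule map_tuple_carrier[OF \<phi>] map_tuple_carrier[OF \<psi>], assumption)+
  finally show "dsum_map S n m \<phi> \<psi> (G i)
      = mat_eval (n + m) (\<gamma> i) (map_tuple g A (dsum_map S n m \<phi> \<psi>))"
    by (simp only: map_tuple_dsum)
qed

section \<open>Closedness, and the inverse of \<phi> \<mapsto> \<phi>(A)\<close>

lemma closedin_UCP: "closedin (product_topology (\<lambda>_. mat_topology n) S) (UCP g r \<gamma> A n)"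
proof -
  \<comment> \<open>The ambient space is the full product and not
    \<open>linear_maps_topology\<close>: the map \<open>lift n\<close> below, along which the set is
    pulled back, may take nonlinear values.\<close>
  let ?P = "product_topology (\<lambda>_. mat_topology n) S"
  have proj: "continuous_map ?P (mat_topology n) (\<lambda>\<phi>. \<phi> T)" if "T \<in> S" for T
    using that by (rule continuous_map_product_projection)
  have "continuous_map ?P (mat_topology n) (\<lambda>\<phi>. map_tuple g A \<phi> j)" if "j < g" for j
    using proj[OF A_in_S[OF that]] that by (simp add: map_tuple_def)
  then have eval: "continuous_map ?P (mat_topology n) (\<lambda>\<phi>. mat_eval n (\<gamma> i) (map_tuple g A \<phi>))"
    if "i < r" for i
    using continuous_map_mat_eval gamma_polys that by blast
  have "closedin ?P {\<phi> \<in> topspace ?P. \<phi> id = 1\<^sub>m n \<and> completely_positive S n \<phi> \<and>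
      (\<forall>i\<in>{..<r}. \<phi> (G i) = mat_eval n (\<gamma> i) (map_tuple g A \<phi>))}"
    by (intro closedin_Conj closedin_Ball closedin_mat_eq[where n = n] closedin_completely_positive
        continuous_map_mat_const proj id_in_S G_in_S eval) auto
  from closedin_Int[OF closedin_linear_maps[OF S_add S_scale] this]
  have "closedin ?P (linear_maps S n \<inter> {\<phi> \<in> topspace ?P. \<phi> id = 1\<^sub>m n \<and>
      completely_positive S n \<phi> \<and> (\<forall>i\<in>{..<r}. \<phi> (G i) = mat_eval n (\<gamma> i) (map_tuple g A \<phi>))})" .
  moreover have "linear_maps S n \<subseteq> topspace ?P"
    by (auto simp: linear_maps_def)
  ultimately show ?thesis
    by (auto simp: UCP_def Int_def elim!: back_subst[of "closedin ?P"])
qed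

text \<open>The coefficients of an element of the operator system need not be unique; choosing them
  independently of \<open>X\<close> makes \<open>lift n X T\<close> a noncommutative polynomial in \<open>X\<close> for each \<open>T\<close>, hence
  continuous in \<open>X\<close>.\<close>

definition coeffs :: "('h \<Rightarrow> 'h) \<Rightarrow> complex \<times> (nat \<Rightarrow> complex)" where
  "coeffs T = (SOME cd. T = op_comb r G (fst cd) (snd cd))"

definition lift :: "nat \<Rightarrow> mtuple \<Rightarrow> ('h \<Rightarrow> 'h) \<Rightarrow> complex mat" where
  "lift n X = (\<lambda>T\<in>S. eval_comb n X (fst (coeffs T)) (snd (coeffs T)))"

lemma op_comb_coeffs:
  assumes "T \<in> S"
  shows "op_comb r G (fst (coeffs T)) (snd (coeffs T)) = T"
proof -
  have "\<exists>cd. T = op_comb r G (fst cd) (snd cd)" using assms by (auto simp: S_iff)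
  from someI_ex[OF this] show ?thesis by (simp add: coeffs_def)
qed

text \<open>On tuples \<phi>(A) the choice of coefficients is immaterial, because
  \<open>UCP_op_comb\<close> holds for every way of writing T.\<close>

lemma lift_map_tuple:
  assumes \<phi>: "\<phi> \<in> UCP g r \<gamma> A n"
  shows "lift n (map_tuple g A \<phi>) = \<phi>"
proof
  fix T
  show "lift n (map_tuple g A \<phi>) T = \<phi> T"
  proof (cases "T \<in> S")
    case True
    then have "lift n (map_tuple g A \<phi>) T = \<phi> (op_comb r G (fst (coeffs T)) (snd (coeffs T)))"
      by (simp add: lift_def UCP_op_comb[OF \<phi>])
    then show ?thesis by (simp only: op_comb_coeffs[OF True])
  next
    case False
    \<comment> \<open>Off S both maps are \<open>undefined\<close>.\<close>
    have "\<phi> \<in> S \<rightarrow>\<^sub>E carrier_mat n n"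
      using UCP_linear[OF \<phi>] by (simp add: linear_maps_def)
    from PiE_arb[OF this False] show ?thesis
      using False by (simp add: lift_def)
  qed
qed

lemma topspace_sa_topology: "topspace (sa_topology g n) = sa_tuples g n"
  by (auto simp: sa_topology_def sa_tuples_def selfadjoint_mats_def PiE_def Pi_def)

lemma continuous_map_sa_proj:
  "j < g \<Longrightarrow> continuous_map (sa_topology g n) (mat_topology n) (\<lambda>X. X j)"
  unfolding sa_topology_def
  by (intro continuous_map_from_subtopology continuous_map_product_projection) simp

lemma continuous_map_lift:
  "continuous_map (sa_topology g n) (product_topology (\<lambda>_. mat_topology n) S) (lift n)"
  unfolding continuous_map_componentwise
proof (intro conjI ballI)
  show "lift n ` topspace (sa_topology g n) \<subseteq> extensional S" by (auto simp: lift_def)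
  fix T assume "T \<in> S"
  then have "(\<lambda>X. lift n X T) = (\<lambda>X. eval_comb n X (fst (coeffs T)) (snd (coeffs T)))"
    by (simp add: lift_def)
  moreover have "continuous_map (sa_topology g n) (mat_topology n)
      (\<lambda>X. eval_comb n X (fst (coeffs T)) (snd (coeffs T)))"
    unfolding eval_comb_def
    by (intro continuous_map_mat_add continuous_map_mat_sum continuous_map_mat_smult
        continuous_map_mat_const continuous_map_mat_eval[OF continuous_map_sa_proj gamma_polys]) auto
  ultimately show "continuous_map (sa_topology g n) (mat_topology n) (\<lambda>X. lift n X T)" by simp
qed

text \<open>This describes W by conditions on X alone. The last one is genuine: the coefficients
  chosen for A_j need not be those of the generator \<gamma>_j. If two of the A_j coincide, for
  instance, they get the same coefficients, and the condition forces the corresponding X_j to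
  coincide.\<close>

lemma W_range_eq:
  "W_range g r \<gamma> A n = {X \<in> sa_tuples g n. lift n X \<in> UCP g r \<gamma> A n \<and> (\<forall>j\<in>{..<g}. lift n X (A j) = X j)}"
proof (intro Set.set_eqI iffI)
  fix X assume "X \<in> W_range g r \<gamma> A n"
  then obtain \<phi> where "\<phi> \<in> UCP g r \<gamma> A n" "X = map_tuple g A \<phi>" by (auto simp: W_range_def)
  then show "X \<in> {X \<in> sa_tuples g n. lift n X \<in> UCP g r \<gamma> A n \<and> (\<forall>j\<in>{..<g}. lift n X (A j) = X j)}"
    using lift_map_tuple map_tuple_in_sa_tuples by (auto simp: map_tuple_def)
next
  fix X assume X: "X \<in> {X \<in> sa_tuples g n. lift n X \<in> UCP g r \<gamma> A n \<and> (\<forall>j\<in>{..<g}. lift n X (A j) = X j)}"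
  have "X = map_tuple g A (lift n X)"
  proof
    fix j show "X j = map_tuple g A (lift n X) j"
      using X PiE_arb[of X "{..<g}" _ j] by (cases "j < g") (auto simp: map_tuple_def sa_tuples_def)
  qed
  moreover have "lift n X \<in> UCP g r \<gamma> A n" using X by simp
  ultimately show "X \<in> W_range g r \<gamma> A n" unfolding W_range_def by (rule image_eqI)
qed

lemma closedin_W_range: "closedin (sa_topology g n) (W_range g r \<gamma> A n)"
proof -
  let ?T = "sa_topology g n"
  have "continuous_map ?T (mat_topology n) (\<lambda>X. lift n X (A j))" if "j < g" for j
    using continuous_map_lift A_in_S[OF that] by (auto simp: continuous_map_componentwise)
  then have "closedin ?T {X \<in> topspace ?T. lift n X \<in> UCP g r \<gamma> A n \<and>
      (\<forall>j\<in>{..<g}. lift n X (A j) = X j)}"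
    by (intro closedin_Conj closedin_Ball closedin_mat_eq[where n = n] continuous_map_sa_proj
        closedin_continuous_map_preimage[OF continuous_map_lift closedin_UCP]) auto
  then show ?thesis by (simp add: W_range_eq topspace_sa_topology)
qed

lemma homeomorphic_map_lift:
  "homeomorphic_map (subtopology (sa_topology g n) (W_range g r \<gamma> A n))
     (subtopology (linear_maps_topology S n) (UCP g r \<gamma> A n)) (lift n)"
proof -
  let ?P = "product_topology (\<lambda>_. mat_topology n) S"
  let ?W = "W_range g r \<gamma> A n" and ?U = "UCP g r \<gamma> A n"
  \<comment> \<open>Since \<Gamma>-ucp maps are linear, the detour through the subspace of linear
    maps does not change their topology, and continuity can be tested in the plain product.\<close>
  have U: "subtopology (linear_maps_topology S n) ?U = subtopology ?P ?U"
    using UCP_linear by (auto simp: linear_maps_topology_def subtopology_subtopology Int_absorb1 subset_iff)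
  have lift_W: "lift n X \<in> ?U \<and> map_tuple g A (lift n X) = X" if "X \<in> ?W" for X
    using that lift_map_tuple by (auto simp: W_range_def)
  have lift: "continuous_map (subtopology (sa_topology g n) ?W) (subtopology ?P ?U) (lift n)"
    using continuous_map_from_subtopology[OF continuous_map_lift] lift_W
    by (auto simp: continuous_map_in_subtopology)
  have "continuous_map ?P (mat_topology n) (\<lambda>\<phi>. map_tuple g A \<phi> j)" if "j < g" for j
    using continuous_map_product_projection[OF A_in_S[OF that]] that by (simp add: map_tuple_def)
  then have "continuous_map ?P (product_topology (\<lambda>_. mat_topology n) {..<g}) (map_tuple g A)"
    by (auto simp: continuous_map_componentwise map_tuple_def)
  from continuous_map_from_subtopology[OF this, of ?U]
  have "continuous_map (subtopology ?P ?U) (subtopology (sa_topology g n) ?W) (map_tuple g A)"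
    using map_tuple_in_sa_tuples
    by (auto simp: sa_topology_def continuous_map_in_subtopology W_range_def)
  with lift have "homeomorphic_maps (subtopology (sa_topology g n) ?W) (subtopology ?P ?U)
      (lift n) (map_tuple g A)"
    using lift_W lift_map_tuple by (auto simp: homeomorphic_maps_def)
  then show ?thesis unfolding U by (rule homeomorphic_maps_imp_map)
qed

section \<open>Boundedness, \<Gamma>-convexity and the isomorphism\<close>

lemma bounded_W_range: "bounded_graded g (W_range g r \<gamma> A)"
  unfolding bounded_graded_def
proof (intro exI conjI allI impI ballI)
  \<comment> \<open>The constant comes from squaring |X_j v| \<le> |A_j| |v| and summing over
    j.\<close>
  define R where "R = sqrt (\<Sum>j<g. (onorm (A j))\<^sup>2)"
  show "0 \<le> R" by (simp add: R_def sum_nonneg)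
  fix n :: nat and X assume "X \<in> W_range g r \<gamma> A n"
  then obtain \<phi> where \<phi>: "\<phi> \<in> UCP g r \<gamma> A n" and X: "X = map_tuple g A \<phi>"
    by (auto simp: W_range_def)
  have sa: "X j \<in> selfadjoint_mats n" if "j < g" for j
    using map_tuple_in_sa_tuples[OF \<phi>] that by (auto simp: X sa_tuples_def)
  have sq: "X j * X j \<in> carrier_mat n n" if "j \<in> {..<g}" for j
    using sa[of j] that by (intro mult_carrier_mat[of _ n n]) (auto simp: selfadjoint_mats_def)
  show "psd n (complex_of_real (R\<^sup>2) \<cdot>\<^sub>m 1\<^sub>m n - mat_sum n (\<lambda>j. X j * X j) {..<g})"
    unfolding psd_def
  proof (intro conjI ballI)
    fix v :: "complex vec" assume v: "v \<in> carrier_vec n"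
    have "(mat_sum n (\<lambda>j. X j * X j) {..<g} *\<^sub>v v) \<bullet>c v = (\<Sum>j<g. (X j *\<^sub>v v) \<bullet>c (X j *\<^sub>v v))"
      by (subst form_mat_sum[OF sq v v], assumption)
        (auto intro!: sum.cong form_selfadjoint_square[OF sa v])
    also have "\<dots> = of_real (\<Sum>j<g. (vec_norm2 (X j *\<^sub>v v))\<^sup>2)"
      by (simp add: cscalar_prod_self)
    finally have sum: "(mat_sum n (\<lambda>j. X j * X j) {..<g} *\<^sub>v v) \<bullet>c v
        = of_real (\<Sum>j<g. (vec_norm2 (X j *\<^sub>v v))\<^sup>2)" .
    have "(\<Sum>j<g. (vec_norm2 (X j *\<^sub>v v))\<^sup>2) \<le> (\<Sum>j<g. (onorm (A j) * vec_norm2 v)\<^sup>2)"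
      using UCP_norm_le[OF \<phi> A_in_S v] vec_norm2_nonneg
      by (intro sum_mono power_mono) (auto simp: X map_tuple_def)
    also have "\<dots> = R\<^sup>2 * (vec_norm2 v)\<^sup>2"
      by (simp add: R_def sum_nonneg power_mult_distrib sum_distrib_right)
    finally have "(\<Sum>j<g. (vec_norm2 (X j *\<^sub>v v))\<^sup>2) \<le> R\<^sup>2 * (vec_norm2 v)\<^sup>2" .
    moreover have "((complex_of_real (R\<^sup>2) \<cdot>\<^sub>m 1\<^sub>m n) *\<^sub>v v) \<bullet>c v = of_real (R\<^sup>2 * (vec_norm2 v)\<^sup>2)"
      using form_smult[OF one_carrier_mat v v] v by (simp add: cscalar_prod_self)
    ultimately show "0 \<le> ((complex_of_real (R\<^sup>2) \<cdot>\<^sub>m 1\<^sub>m n - mat_sum n (\<lambda>j. X j * X j) {..<g}) *\<^sub>v v) \<bullet>c v"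
      unfolding form_minus[OF smult_carrier_mat[OF one_carrier_mat] mat_sum_carrier v v] sum
      by (simp add: less_eq_complex_def)
  qed (intro minus_carrier_mat mat_sum_carrier)
qed

lemma gamma_convex_W_range: "gamma_convex g r \<gamma> (W_range g r \<gamma> A)"
  unfolding gamma_convex_def graded_set_def free_set_def
proof (intro conjI allI impI ballI)
  show "W_range g r \<gamma> A n \<subseteq> sa_tuples g n" for n
    by (auto simp: W_range_eq)
  show "dsum_tuple g n m X Y \<in> W_range g r \<gamma> A (n + m)"
    if "X \<in> W_range g r \<gamma> A n" "Y \<in> W_range g r \<gamma> A m" for n m X Y
    using that dsum_in_UCP by (auto simp: W_range_def map_tuple_dsum[symmetric])
  show pair: "compress_tuple g V X \<in> W_range g r \<gamma> A m"
    if "X \<in> W_range g r \<gamma> A n" "gamma_pair g r \<gamma> n m X V" for n m X V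
    using that compress_in_UCP by (auto simp: W_range_def map_tuple_compress[symmetric])
  show "compress_tuple g U X \<in> W_range g r \<gamma> A n"
    if "X \<in> W_range g r \<gamma> A n" "unitary_mat n U" for n X U
    using that gamma_pair_unitary by (intro pair) (auto simp: W_range_def)
qed

lemma gamma_convex_maps_UCP: "gamma_convex_maps g r \<gamma> A (UCP g r \<gamma> A)"
  unfolding gamma_convex_maps_def
  by (intro conjI allI impI ballI subsetI)
    (auto intro: UCP_linear dsum_in_UCP compress_in_UCP gamma_pair_unitary)

text \<open>The isomorphism is \<open>lift n\<close>. For X = \<phi>(A) both sides of the
  compatibility equation are the compression of \<phi>, since that compression is again \<Gamma>-ucp
  and is recovered from its tuple.\<close>

lemma gamma_isomorphic_W_range_UCP:
  "gamma_isomorphic (gamma_pair g r \<gamma>)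
     (sa_topology g) (compress_tuple g) (W_range g r \<gamma> A)
     (linear_maps_topology S) (compress_map S) (UCP g r \<gamma> A)"
  unfolding gamma_isomorphic_def
proof (intro exI conjI allI impI ballI)
  fix n m X V
  assume "X \<in> W_range g r \<gamma> A n" and pair: "gamma_pair g r \<gamma> n m X V"
  then obtain \<phi> where \<phi>: "\<phi> \<in> UCP g r \<gamma> A n" and X: "X = map_tuple g A \<phi>"
    by (auto simp: W_range_def)
  show "compress_map S V (lift n X) = lift m (compress_tuple g V X)"
    using lift_map_tuple[OF compress_in_UCP[OF \<phi>]] pair lift_map_tuple[OF \<phi>]
    by (simp add: X map_tuple_compress)
qed (rule homeomorphic_map_lift)

end

theorem proposition2p16:
  fixes g r :: nat
    and \<gamma> :: "nat \<Rightarrow> ncpoly"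
    and A :: "nat \<Rightarrow> 'h::complex_hilbert_space \<Rightarrow> 'h"
  assumes "1 \<le> g" and "g \<le> r"
    and "\<forall>i<r. \<gamma> i \<in> nc_polys g \<and> nc_star (\<gamma> i) = \<gamma> i"
    and "\<forall>j<g. \<gamma> j = nc_var j"
    and "\<forall>j<g. bounded_clinear (A j) \<and> selfadjoint_op (A j)"
  shows "gamma_convex g r \<gamma> (W_range g r \<gamma> A)
    \<and> closed_graded g (W_range g r \<gamma> A)
    \<and> bounded_graded g (W_range g r \<gamma> A)
    \<and> gamma_convex_maps g r \<gamma> A (UCP g r \<gamma> A)
    \<and> closed_graded_maps r \<gamma> A (UCP g r \<gamma> A)
    \<and> bounded_graded_maps r \<gamma> A (UCP g r \<gamma> A)
    \<and> gamma_isomorphic (gamma_pair g r \<gamma>)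
        (sa_topology g) (compress_tuple g) (W_range g r \<gamma> A)
        (linear_maps_topology (R_space r \<gamma> A)) (compress_map (R_space r \<gamma> A)) (UCP g r \<gamma> A)"
proof -
  interpret gamma_tuple g r \<gamma> A
    using assms by unfold_locales auto
  have "closed_graded_maps r \<gamma> A (UCP g r \<gamma> A)"
    unfolding closed_graded_maps_def linear_maps_topology_def
    using closedin_UCP UCP_linear by (intro allI impI closedin_subset_topspace) auto
  moreover have "bounded_graded_maps r \<gamma> A (UCP g r \<gamma> A)"
    \<comment> \<open>\<Gamma>-ucp maps are contractive, so C = 1 serves at every level.\<close>
    unfolding bounded_graded_maps_def using UCP_norm_le by (intro exI[of _ 1]) simp
  ultimately show ?thesis
    using gamma_convex_W_range closedin_W_range bounded_W_range gamma_convex_maps_UCP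
      gamma_isomorphic_W_range_UCP
    by (simp add: closed_graded_def)
qed

end
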